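(* Let $q\ge3$ be an integer, and let $\mathsf{S}$, $\mathsf{V}_i^q$, $\mathsf{H}_i^q$, $I_i^q$ ($0\le i\le q-2$), $R_{q,i}$, $\widetilde{\mathscr{F}}_q:\mathsf{S}\to\mathsf{S}$ and $\mathscr{F}_q:(0,1]\to(0,1]$ be as defined in the context. For $i\in\{0,q-2\}$ define $$n_i^q(a):=\min\{n\in\mathbb{N}\mid\mathscr{F}_q^n(a)\notin I_i^q\},$$ and let $\mathsf{R}^q:=\mathsf{S}\setminus\left((\mathsf{H}_0^q\cap\mathsf{V}_{q-2}^q)\cup(\mathsf{H}_{q-2}^q\cap\mathsf{V}_0^q)\right)$. Then the map $\widetilde{\mathscr{G}}_q:\mathsf{R}^q\to\mathsf{R}^q$ given by $$\widetilde{\mathscr{G}}_q(a,s):=\begin{cases}\widetilde{\mathscr{F}}_q^{\,n_0^q(a)}(a,s), & a\in I_0^q=(\lambda_q/(\lambda_q+1),1],\\ \widetilde{\mathscr{F}}_q(a,s), & a\notin I_0^q\cup I_{q-2}^q,\\ \widetilde{\mathscr{F}}_q^{\,n_{q-2}^q(a)}(a,s), & a\in I_{q-2}^q=(0,1/(\lambda_q+1)],\end{cases}$$ is almost everywhere bijective and preserves the Lebesgue measure $da\,ds$ on $\mathsf{R}^q$. Consequently, $\widetilde{\mathscr{G}}_q$ is a model of the natural extension of the map $\mathscr{G}_q:(0,1]\to(0,1]$ defined by $$\mathscr{G}_q(a):=\begin{cases}\mathscr{F}_q^{\,n_0^q(a)}(a), & a\in I_0^q,\\ \mathscr{F}_q(a),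 & a\notin I_0^q\cup I_{q-2}^q,\\ \mathscr{F}_q^{\,n_{q-2}^q(a)}(a), & a\in I_{q-2}^q.\end{cases}$$ Moreover, $\mathscr{G}_q$ preserves the finite measure on $(0,1]$ given by $$d\mu_{\mathscr{G}_q}:=\begin{cases}\left(R_{q,q-2}(a,1-a)-R_{q,0}(a,1-a)\right)da=\dfrac{\lambda_q\,da}{a(a+\lambda_q(1-a))}, & a\in I_0^q,\\[2mm] \dfrac{da}{a(1-a)}, & a\notin I_0^q\cup I_{q-2}^q,\\[2mm] \left(R_{q,q-1}(a,1-a)-R_{q,1}(a,1-a)\right)da=\dfrac{\lambda_q\,da}{(1-a)((1-a)+\lambda_qa)}, & a\in I_{q-2}^q.\end{cases}$$
   Context: Let $q\ge3$ be an integer and $\lambda_q:=2\cos(\pi/q)$. Put $T_q:=\begin{pmatrix}1&\lambda_q\\0&1\end{pmatrix}$, $U_q:=\begin{pmatrix}\lambda_q&-1\\1&0\end{pmatrix}$ and, for $i=0,1,\dots,q-1$, $\mathfrak{w}_i^q=(x_i^q,y_i^q)^T:=U_q^i(1,0)^T$. (So $\mathfrak{w}_0^q=(1,0)^T$, $\mathfrak{w}_1^q=(\lambda_q,1)^T$, $\mathfrak{w}_{q-2}^q=(1,\lambda_q)^T$, $\mathfrak{w}_{q-1}^q=(0,1)^T$.) For $i=0,\dots,q-2$, $M_i^q:=U_q^iT_q$ is the matrix whose columns are $\mathfrak{w}_i^q$ and $\mathfrak{w}_{i+1}^q$, and $\rho_i^q(a):=(x_{i+1}^q-y_i^q)a+(x_i^q-x_{i+1}^q)$.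 Matrices: $h_s:=\begin{pmatrix}1&0\\-s&1\end{pmatrix}$, $g_t:=\begin{pmatrix}e^t&0\\0&e^{-t}\end{pmatrix}$ for $s,t\in\mathbb{R}$, and $g_{a,b}:=\begin{pmatrix}a&b\\0&a^{-1}\end{pmatrix}$ for $a>0$, $b\in\mathbb{R}$. For $i=0,\dots,q-1$, $R_{q,i}(a,b):=\dfrac{y_i^q}{a(x_i^qa+y_i^qb)}$, so $R_{q,0}=0$ and $R_{q,q-1}(a,1-a)=\frac{1}{a(1-a)}$, with the convention that this is $+\infty$ at $a=1$. Intervals: for $i=0,\dots,q-2$, $I_i^q:=\left(\frac{x_{i+1}^q}{x_{i+1}^q+y_{i+1}^q},\frac{x_i^q}{x_i^q+y_i^q}\right]$; these partition $(0,1]$. $\mathsf{S}:=\{(a,s)\in\mathbb{R}^2\mid a\in(0,1],\ 0\le s<\frac{1}{a(1-a)}\}$ (with $\frac{1}{a(1-a)}=+\infty$ at $a=1$), and for $i=0,\dots,q-2$: $\mathsf{H}_i^q:=\{(a,s)\in\mathsf{S}\mid R_{q,i}(a,1-a)\le s<R_{q,i+1}(a,1-a)\}$ and $\mathsf{V}_i^q:=\{(a,s)\in\mathsf{S}\mid a\in I_i^q\}$. The symmetric $G_q$-Farey map $\mathscr{F}_q:(0,1]\to(0,1]$ is defined for $a\in I_i^q$ by $\mathscr{F}_q(a):=\dfrac{(x_{i+1}^q+y_{i+1}^q)a-x_{i+1}^q}{(x_{i+1}^q-y_i^q)a+(x_i^q-x_{i+1}^q)}$ (this equals $\frac{1}{1+m}$,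 where $m$ is the slope of $(M_i^q)^{-1}(a,1-a)^T$). The map $\widetilde{\mathscr{F}}_q:\mathsf{S}\to\mathsf{S}$ sends $(a,s)\in\mathsf{V}_i^q$ to the point $(a',s')$ determined by $h_{s'}g_{a',1-a'}=g_{-\log\rho_i^q(a)}h_sg_{a,1-a}\left((M_i^q)^{-1}\right)^T$; its first coordinate is $a'=\mathscr{F}_q(a)$. The point $a=1$ is fixed by $\mathscr{F}_q$, so $n_0^q(1)$ is not finite; the maps $\widetilde{\mathscr{G}}_q$, $\mathscr{G}_q$ are considered up to the null set $\{a=1\}$. "Natural extension" is meant in the usual sense, with factor map the projection $\pi(a,s)=a$: $\widetilde{\mathscr{G}}_q$ is an essentially invertible measure-preserving map of $\mathsf{R}^q$, $\pi\circ\widetilde{\mathscr{G}}_q=\mathscr{G}_q\circ\pi$ almost everywhere, the measure on $(0,1]$ is obtained by integrating $da\,ds$ over the $s$-fibers of $\pi$ in $\mathsf{R}^q$, and, modulo null sets, the Borel $\sigma$-algebra of $\mathsf{R}^q$ is generated by $\bigcup_{n\ge0}\widetilde{\mathscr{G}}_q^{\,n}\left(\pi^{-1}\mathcal{B}\right)$, where $\mathcal{B}$ is the Borel $\sigma$-algebra of $(0,1]$. *)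

theory Defs
  imports "HOL-Analysis.Analysis"
begin

section \<open>Hecke triangle groups: vectors and matrices\<close>

definition hecke_lambda :: "nat \<Rightarrow> real" where
  "hecke_lambda q = 2 * cos (pi / real q)"

definition mat2 :: "real \<Rightarrow> real \<Rightarrow> real \<Rightarrow> real \<Rightarrow> real^2^2" where
  "mat2 a b c d = vector [vector [a, b], vector [c, d]]"

definition T_mat :: "nat \<Rightarrow> real^2^2" where
  "T_mat q = mat2 1 (hecke_lambda q) 0 1"

definition U_mat :: "nat \<Rightarrow> real^2^2" where
  "U_mat q = mat2 (hecke_lambda q) (-1) 1 0"

text \<open>Multiplication \<open>*\<close> on \<^typ>\<open>real^2^2\<close> is componentwise, so matrix powers are
  written as iterated matrix products \<open>**\<close>.\<close>

definition U_pow :: "nat \<Rightarrow> nat \<Rightarrow> real^2^2" where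
  "U_pow q i = (((**) (U_mat q)) ^^ i) (mat 1)"

definition w_vec :: "nat \<Rightarrow> nat \<Rightarrow> real^2" where
  "w_vec q i = U_pow q i *v vector [1, 0]"

definition xw :: "nat \<Rightarrow> nat \<Rightarrow> real" where
  "xw q i = w_vec q i $ 1"

definition yw :: "nat \<Rightarrow> nat \<Rightarrow> real" where
  "yw q i = w_vec q i $ 2"

definition M_mat :: "nat \<Rightarrow> nat \<Rightarrow> real^2^2" where
  "M_mat q i = U_pow q i ** T_mat q"

definition rho :: "nat \<Rightarrow> nat \<Rightarrow> real \<Rightarrow> real" where
  "rho q i a = (xw q (i + 1) - yw q i) * a + (xw q i - xw q (i + 1))"

definition h_mat :: "real \<Rightarrow> real^2^2" where
  "h_mat s = mat2 1 0 (- s) 1"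

definition g_diag :: "real \<Rightarrow> real^2^2" where
  "g_diag t = mat2 (exp t) 0 0 (exp (- t))"

definition g_upper :: "real \<Rightarrow> real \<Rightarrow> real^2^2" where
  "g_upper a b = mat2 a b 0 (inverse a)"


section \<open>The Farey map and its extension\<close>

text \<open>The bounds for \<open>s\<close> take values in \<^typ>\<open>ereal\<close>, where \<open>1 / 0 = \<infinity>\<close>.  This realizes
  the convention that \<open>1 / (a * (1 - a))\<close>, and likewise \<open>R_fun q (q - 1) a (1 - a)\<close>,
  is \<open>\<infinity>\<close> at \<open>a = 1\<close>.\<close>

definition R_fun :: "nat \<Rightarrow> nat \<Rightarrow> real \<Rightarrow> real \<Rightarrow> ereal" where
  "R_fun q i a b = ereal (yw q i) / ereal (a * (xw q i * a + yw q i * b))"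

definition I_set :: "nat \<Rightarrow> nat \<Rightarrow> real set" where
  "I_set q i =
    {xw q (i + 1) / (xw q (i + 1) + yw q (i + 1)) <.. xw q i / (xw q i + yw q i)}"

definition S_set :: "(real \<times> real) set" where
  "S_set = {(a, s). a \<in> {0<..1} \<and> 0 \<le> s \<and> ereal s < 1 / ereal (a * (1 - a))}"

definition H_set :: "nat \<Rightarrow> nat \<Rightarrow> (real \<times> real) set" where
  "H_set q i = {(a, s) \<in> S_set.
     R_fun q i a (1 - a) \<le> ereal s \<and> ereal s < R_fun q (i + 1) a (1 - a)}"

definition V_set :: "nat \<Rightarrow> nat \<Rightarrow> (real \<times> real) set" where
  "V_set q i = {(a, s) \<in> S_set. a \<in> I_set q i}"

definition cell_index :: "nat \<Rightarrow> real \<Rightarrow> nat" where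
  "cell_index q a = (THE i. i \<le> q - 2 \<and> a \<in> I_set q i)"

definition farey :: "nat \<Rightarrow> real \<Rightarrow> real" where
  "farey q a = (let i = cell_index q a in
     ((xw q (i + 1) + yw q (i + 1)) * a - xw q (i + 1)) /
     ((xw q (i + 1) - yw q i) * a + (xw q i - xw q (i + 1))))"

definition farey_ext :: "nat \<Rightarrow> real \<times> real \<Rightarrow> real \<times> real" where
  "farey_ext q = (\<lambda>(a, s). let i = cell_index q a in
     THE (a', s'). (a', s') \<in> S_set \<and>
       h_mat s' ** g_upper a' (1 - a') =
       g_diag (- ln (rho q i a)) ** h_mat s ** g_upper a (1 - a) **
         transpose (matrix_inv (M_mat q i)))"


section \<open>The accelerated maps\<close>

text \<open>An orbit that never leaves \<open>I_set q i\<close> gets exit time \<open>0\<close>.  For \<open>a\<close> in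
  \<open>I_set q i\<close> with \<open>i\<close> one of \<open>0\<close>, \<open>q - 2\<close> this happens only at the fixed point \<open>a = 1\<close>;
  so the accelerated maps, which are considered up to the null set \<open>a = 1\<close>, are the
  identity there.\<close>

definition exit_time :: "nat \<Rightarrow> nat \<Rightarrow> real \<Rightarrow> nat" where
  "exit_time q i a =
    (if \<exists>n. (farey q ^^ n) a \<notin> I_set q i
     then LEAST n. (farey q ^^ n) a \<notin> I_set q i else 0)"

definition gauss :: "nat \<Rightarrow> real \<Rightarrow> real" where
  "gauss q a =
    (if a \<in> I_set q 0 then (farey q ^^ exit_time q 0 a) a
     else if a \<in> I_set q (q - 2) then (farey q ^^ exit_time q (q - 2) a) a
     else farey q a)"

definition gauss_ext :: "nat \<Rightarrow> real \<times> real \<Rightarrow> real \<times> real" where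
  "gauss_ext q = (\<lambda>(a, s).
    (if a \<in> I_set q 0 then (farey_ext q ^^ exit_time q 0 a) (a, s)
     else if a \<in> I_set q (q - 2) then (farey_ext q ^^ exit_time q (q - 2) a) (a, s)
     else farey_ext q (a, s)))"

definition R_set :: "nat \<Rightarrow> (real \<times> real) set" where
  "R_set q = S_set -
     ((H_set q 0 \<inter> V_set q (q - 2)) \<union> (H_set q (q - 2) \<inter> V_set q 0))"

definition R_measure :: "nat \<Rightarrow> (real \<times> real) measure" where
  "R_measure q = restrict_space lborel (R_set q)"

definition gauss_density :: "nat \<Rightarrow> real \<Rightarrow> real" where
  "gauss_density q a =
    (if a \<in> I_set q 0 then hecke_lambda q / (a * (a + hecke_lambda q * (1 - a)))
     else if a \<in> I_set q (q - 2)
       then hecke_lambda q / ((1 - a) * ((1 - a) + hecke_lambda q * a))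
     else 1 / (a * (1 - a)))"

definition gauss_measure :: "nat \<Rightarrow> real measure" where
  "gauss_measure q =
     density (restrict_space lborel {0<..1}) (\<lambda>a. ennreal (gauss_density q a))"


section \<open>Ergodic-theoretic notions\<close>

definition measure_preserving :: "'a measure \<Rightarrow> ('a \<Rightarrow> 'a) \<Rightarrow> bool" where
  "measure_preserving M T \<longleftrightarrow> T \<in> M \<rightarrow>\<^sub>M M \<and> distr M M T = M"

definition bijective_on_conull :: "'a measure \<Rightarrow> ('a \<Rightarrow> 'a) \<Rightarrow> 'a set \<Rightarrow> bool" where
  "bijective_on_conull M T X \<longleftrightarrow>
     X \<in> sets M \<and> space M - X \<in> null_sets M \<and> bij_betw T X X"

definition ae_bijective :: "'a measure \<Rightarrow> ('a \<Rightarrow> 'a) \<Rightarrow> bool" where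
  "ae_bijective M T \<longleftrightarrow> (\<exists>X. bijective_on_conull M T X)"

text \<open>\<open>(M, T)\<close> is a natural extension of \<open>(N, G)\<close> with factor map \<open>p\<close>.  The forward images
  of \<open>p -` E\<close> under \<open>T\<close> are taken inside a conull set on which \<open>T\<close> is a bijection, so that
  they are not affected by the values of \<open>T\<close> on a null set, and are measurable because the
  inverse is.\<close>

definition natural_extension ::
  "'a measure \<Rightarrow> ('a \<Rightarrow> 'a) \<Rightarrow> 'b measure \<Rightarrow> ('b \<Rightarrow> 'b) \<Rightarrow> ('a \<Rightarrow> 'b) \<Rightarrow> bool" where
  "natural_extension M T N G p \<longleftrightarrow>
     measure_preserving M T \<and>
     p \<in> M \<rightarrow>\<^sub>M N \<and> distr M N p = N \<and>
     (AE z in M. p (T z) = G (p z)) \<and>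
     (\<exists>X. bijective_on_conull M T X \<and>
        the_inv_into X T \<in> restrict_space M X \<rightarrow>\<^sub>M restrict_space M X \<and>
        (\<forall>A \<in> sets M.
           \<exists>B \<in> sigma_sets X {(T ^^ n) ` (p -` E \<inter> X) | n E. E \<in> sets N}.
             sym_diff A B \<in> null_sets M))"

end

theory Submission
  imports Defs
begin

text \<open>A point \<open>(a, s)\<close> of \<open>S_set\<close> is encoded by the two directions \<open>(a, b)\<close> and \<open>(r, p)\<close> with
  \<open>b = 1 - a\<close>, \<open>p = s a\<close>, \<open>r = 1 / a - s b\<close>.  On the cell \<open>i\<close> the extended Farey map applies
  the inverse of \<open>M_mat q i\<close> to the first one and its transpose, which is \<open>M_mat q (q - 2 - i)\<close>, to
  the second one.  Hence the involution \<open>flip\<close> exchanging the two directions conjugates the map to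
  its inverse and exchanges the sets \<open>V_set\<close> and \<open>H_set\<close>; in particular the map is a bijection of
  \<open>S_set\<close>.  On the fibres over \<open>a\<close> it is affine with slope \<open>rho\<^sup>2\<close>, while the derivative of the Farey
  map is \<open>1 / rho\<^sup>2\<close>, so it preserves the area.  Away from \<open>a = 1\<close>, \<open>gauss_ext\<close> is the first return
  map to \<open>R_set\<close>, and \<open>R_set\<close> is invariant under \<open>flip\<close>, so backward recurrence follows from forward
  recurrence.  The \<open>s\<close>-coordinate is recovered from the \<open>a\<close>-coordinates of the past because the
  fibres contract.\<close>

section \<open>Matrices, sines and the flip\<close>

text \<open>The rows of \<open>h_mat s ** g_upper a b\<close> are \<open>(a, b)\<close> and
  \<open>(- p, r)\<close>, so the determinant gives \<open>a * r + b * p = 1\<close>, and the right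
  factor \<open>transpose (matrix_inv M)\<close> acts on both rows at once; the diagonal factor
  restores \<open>a + b = 1\<close>. This is why two directions carry the whole map. Two obstacles
  shape the rest. Since \<open>1 / (a * (1 - a))\<close> is not integrable, \<open>S_set\<close> has
  infinite area, and Poincare recurrence does not give the return to \<open>R_set\<close>. Instead,
  the first branch translates \<open>a / (1 - a)\<close> and the last branch its reciprocal by
  \<open>- hecke_lambda q\<close>, so every orbit except the fixed point leaves an end cell after
  finitely many steps. These branches are parabolic, so no uniform exponential contraction of the
  fibres can be expected. The estimate after \<open>k\<close> Farey steps is of order
  \<open>1 / k\<close>, with a constant that depends on the first coordinate reached at the end.
  This suffices, because in the reconstruction from the past that end point is the given point and
  stays fixed.\<close>

lemma vector2_nth [simp]:
  "(vector [x, y] :: 'a::zero^2) $ 1 = x" "(vector [x, y] :: 'a::zero^2) $ 2 = y"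
  by (simp_all add: vector_def)

lemma mat2_nth [simp]:
  "mat2 a b c d $ 1 $ 1 = a" "mat2 a b c d $ 1 $ 2 = b"
  "mat2 a b c d $ 2 $ 1 = c" "mat2 a b c d $ 2 $ 2 = d"
  by (simp_all add: mat2_def)

lemma mat2_eq_iff: "mat2 a b c d = mat2 a' b' c' d' \<longleftrightarrow> a = a' \<and> b = b' \<and> c = c' \<and> d = d'"
  by (auto simp: vec_eq_iff forall_2)

lemma mat2_mult:
  "mat2 a b c d ** mat2 a' b' c' d' =
     mat2 (a * a' + b * c') (a * b' + b * d') (c * a' + d * c') (c * b' + d * d')"
  by (simp add: vec_eq_iff forall_2 matrix_matrix_mult_def sum_2)

lemma mat2_transpose: "transpose (mat2 a b c d) = mat2 a c b d"
  by (simp add: vec_eq_iff forall_2 transpose_def)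

lemma mat2_one: "mat 1 = mat2 1 0 0 1"
  by (simp add: vec_eq_iff forall_2 mat_def)

text \<open>\<open>matrix_inv\<close> is a Hilbert choice; the adjugate is a two-sided inverse, and
  uniqueness of inverses identifies the choice with it.\<close>

lemma mat2_inv:
  assumes "a * d - b * c = 1"
  shows "matrix_inv (mat2 a b c d) = mat2 d (- b) (- c) a"
proof -
  have "mat2 a b c d ** mat2 d (- b) (- c) a = mat 1" "mat2 d (- b) (- c) a ** mat2 a b c d = mat 1"
    using assms by (simp_all add: mat2_mult mat2_one mat2_eq_iff algebra_simps)
  moreover from this have "mat2 a b c d ** matrix_inv (mat2 a b c d) = mat 1"
    unfolding matrix_inv_def by (metis (mono_tags, lifting) someI_ex)
  ultimately show ?thesis
    by (metis matrix_mul_assoc matrix_mul_lid matrix_mul_rid)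
qed

text \<open>These are the values U_(i-1)(cos(pi/q)) of the Chebyshev polynomials of the second kind;
  \<open>w_vec q i\<close> turns out to have the coordinates number \<open>i + 1\<close> and
  \<open>i\<close>.\<close>

definition sin_quot :: "nat \<Rightarrow> nat \<Rightarrow> real" where
  "sin_quot q i = sin (real i * (pi / real q)) / sin (pi / real q)"

text \<open>On the points of \<open>S_set\<close> the Farey extension acts linearly on the pair of vectors
  \<open>(a, b)\<close> and \<open>(p, r)\<close>; \<open>pt\<close> depends only on their directions, so normalizing factors
  such as \<open>rho\<close> never appear.  A point \<open>(a, s)\<close> has \<open>b = 1 - a\<close>, \<open>p = s a\<close> and
  \<open>r = 1 / a - s b\<close>, the entries of \<open>h_mat s ** g_upper a b\<close> up to sign.\<close>

definition pt :: "real \<Rightarrow> real \<Rightarrow> real \<Rightarrow> real \<Rightarrow> real \<times> real" where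
  "pt a b p r = (a / (a + b), (a + b)\<^sup>2 * p / (a * (a * r + b * p)))"

text \<open>In terms of \<open>pt\<close> this exchanges \<open>a\<close> with \<open>r\<close> and
  \<open>b\<close> with \<open>p\<close>, which preserves the pairing
  \<open>a * r + b * p\<close>.\<close>

definition flip :: "real \<times> real \<Rightarrow> real \<times> real" where
  "flip = (\<lambda>(a, s). pt (1 / a - s * (1 - a)) (s * a) (1 - a) a)"

section \<open>Direction coordinates on \<open>S_set\<close>\<close>

lemma S_set_iff: "(a, s) \<in> S_set \<longleftrightarrow> 0 < a \<and> a \<le> 1 \<and> 0 \<le> s \<and> s * a * (1 - a) < 1"
proof (cases "0 < a \<and> a < 1")
  case True
  then have pos: "0 < a * (1 - a)" by simp
  then have "1 / ereal (a * (1 - a)) = ereal (1 / (a * (1 - a)))"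
    by (metis ereal_divide order_less_irrefl one_ereal_def)
  with True pos show ?thesis
    by (auto simp: S_set_def less_divide_eq mult.assoc)
next
  case False
  have "ereal s < 1 / ereal 0"
    by (simp add: one_ereal_def)
  with False show ?thesis
    by (cases "a = 1") (auto simp: S_set_def simp del: ereal_divide)
qed

text \<open>The upper bound on the second coordinate becomes \<open>b * p < a * r + b * p\<close>,
  which is the positivity of \<open>a * r\<close>.\<close>

lemma pt_in_S: 
  assumes "0 < a" "0 \<le> b" "0 \<le> p" "0 < r"
  shows "pt a b p r \<in> S_set"
proof -
  have *: "0 < a * r" "0 \<le> b * p" "0 < a + b" using assms by auto
  then have **: "0 < a * r + b * p" by linarith
  have "(a + b)\<^sup>2 * p / (a * (a * r + b * p)) * (a / (a + b)) * (1 - a / (a + b)) = b * p / (a * r + b * p)"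
    using * ** assms by (simp add: divide_simps power2_eq_square)
  also have "\<dots> < 1" using ** * by simp
  finally show ?thesis
    using assms * ** by (simp add: pt_def S_set_iff)
qed

lemma S_set_pt:
  assumes "(a, s) \<in> S_set"
  shows "(a, s) = pt a (1 - a) (s * a) (1 / a - s * (1 - a))"
    and "0 < a" "0 \<le> 1 - a" "0 \<le> s * a" "0 < 1 / a - s * (1 - a)"
  using assms by (auto simp: S_set_iff pt_def field_simps power2_eq_square)

lemma S_set_cases:
  assumes "z \<in> S_set"
  obtains a b p r where "z = pt a b p r" "0 < a" "0 \<le> b" "0 \<le> p" "0 < r"
  using S_set_pt[of "fst z" "snd z"] assms by (metis prod.collapse)

lemma pt_scale:
  assumes "0 < a" "0 \<le> b" "0 \<le> p" "0 < r" "0 < k" "0 < l"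
  shows "pt (k * a) (k * b) (l * p) (l * r) = pt a b p r"
proof -
  define u D where "u = a + b" and "D = a * r + b * p"
  have *: "k * a + k * b = k * u" "k * a * (l * r) + k * b * (l * p) = k * l * D"
    by (simp_all add: u_def D_def algebra_simps)
  show ?thesis
    using assms unfolding pt_def * u_def[symmetric] D_def[symmetric]
    by (simp add: power_mult_distrib power2_eq_square)
qed

lemma flip_pt:
  assumes "0 < a" "0 \<le> b" "0 \<le> p" "0 < r"
  shows "flip (pt a b p r) = pt r p b a"
proof -
  define u D where "u = a + b" and "D = a * r + b * p"
  have pos: "0 < u" "0 < D"
    using assms by (auto simp: u_def D_def intro: add_pos_nonneg)
  let ?a = "a / u" and ?s = "u\<^sup>2 * p / (a * D)"
  have b: "b = u - a" by (simp add: u_def)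
  have 1: "1 - ?a = (1 / u) * b" using pos by (simp add: b field_simps)
  have 2: "?s * ?a = u / D * p"
    using assms(1) pos by (simp add: power2_eq_square)
  have "1 / ?a - ?s * (1 - ?a) = u / a - u * p * b / (a * D)"
    unfolding 1 using assms(1) pos by (simp add: power2_eq_square)
  also have "\<dots> = u * (D - p * b) / (a * D)"
    using assms(1) pos by (simp add: field_simps)
  also have "D - p * b = a * r" by (simp add: D_def)
  finally have 3: "1 / ?a - ?s * (1 - ?a) = u / D * r"
    using assms(1) by simp
  have "flip (pt a b p r) = pt (u / D * r) (u / D * p) ((1 / u) * b) ((1 / u) * a)"
    unfolding flip_def pt_def[of a b p r] prod.case u_def[symmetric] D_def[symmetric] 3 2 using 1 by simp
  also have "\<dots> = pt r p b a"
    using assms pos by (intro pt_scale) auto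
  finally show ?thesis .
qed

lemma flip_in_S: "z \<in> S_set \<Longrightarrow> flip z \<in> S_set"
  by (elim S_set_cases) (simp add: flip_pt pt_in_S)

lemma flip_flip: "z \<in> S_set \<Longrightarrow> flip (flip z) = z"
  by (elim S_set_cases) (simp add: flip_pt)

text \<open>The first coordinate after the flip is \<open>r / (r + p)\<close>, which equals 1
  exactly when \<open>p = s * a\<close> vanishes.\<close>

lemma fst_flip_eq_1: "(a, s) \<in> S_set \<Longrightarrow> fst (flip (a, s)) = 1 \<longleftrightarrow> s = 0"
  using S_set_pt[of a s] by (auto simp: flip_def pt_def field_simps)

context
  fixes q :: nat
  assumes q3: "q \<ge> 3"
begin

section \<open>Arithmetic of the sine quotients\<close>

lemma sin_pi_q: "sin (pi / real q) > 0"
  using q3 by (intro sin_gt_zero) (auto simp: field_simps)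

lemma sin_quot_simps [simp]: "sin_quot q 0 = 0" "sin_quot q (Suc 0) = 1"
  using sin_pi_q by (simp_all add: sin_quot_def)

lemma sin_quot_rec: "sin_quot q (Suc (Suc i)) = hecke_lambda q * sin_quot q (Suc i) - sin_quot q i"
proof -
  define t where "t = pi / real q"
  have "sin (real (Suc i) * t + t) + sin (real (Suc i) * t - t) = 2 * cos t * sin (real (Suc i) * t)"
    by (simp add: sin_add sin_diff)
  moreover have "real (Suc i) * t + t = real (Suc (Suc i)) * t" "real (Suc i) * t - t = real i * t"
    by (simp_all add: algebra_simps)
  ultimately show ?thesis
    using sin_pi_q unfolding sin_quot_def hecke_lambda_def t_def by (simp add: field_simps)
qed

lemma sin_quot_reflect: "i \<le> q \<Longrightarrow> sin_quot q (q - i) = sin_quot q i"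
proof -
  assume "i \<le> q"
  then have "real (q - i) * (pi / real q) = pi - real i * (pi / real q)"
    using q3 by (simp add: of_nat_diff field_simps)
  then show ?thesis by (simp add: sin_quot_def)
qed

text \<open>The sine increases up to the right angle, so the quotient is at least its value at
  \<open>i = 1\<close>; the larger angles follow by reflection.\<close>

lemma sin_quot_ge_1: "0 < i \<Longrightarrow> i < q \<Longrightarrow> 1 \<le> sin_quot q i"
proof -
  assume i: "0 < i" "i < q"
  have *: "1 \<le> sin_quot q i" if i: "0 < i" "2 * i \<le> q" for i
  proof -
    have "pi / real q \<le> real i * (pi / real q)" "real i * (pi / real q) \<le> pi / 2"
      using i q3 of_nat_mono[OF i(2), where 'a=real] by (auto simp: field_simps)
    moreover have "- (pi / 2) \<le> pi / real q" 
      by (rule order_trans[of _ 0]) auto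
    ultimately have "sin (pi / real q) \<le> sin (real i * (pi / real q))"
      by (intro sin_monotone_2pi_le) auto
    then show ?thesis
      using sin_pi_q by (simp add: sin_quot_def)
  qed
  show ?thesis
  proof (cases "2 * i \<le> q")
    case False
    then show ?thesis using *[of "q - i"] i sin_quot_reflect[of i] by simp
  qed (use * i in simp)
qed

lemma sin_quot_ge_0: "i \<le> q \<Longrightarrow> 0 \<le> sin_quot q i"
  using sin_quot_ge_1[of i] sin_quot_reflect[of 0] by (cases "i = 0 \<or> i = q") auto

text \<open>The recurrence makes the left side independent of \<open>i\<close>; it is the
  determinant of \<open>M_mat q i\<close>.\<close>

lemma sin_quot_det: "sin_quot q (Suc i) * sin_quot q (Suc i) - sin_quot q (Suc (Suc i)) * sin_quot q i = 1"
proof (induction i)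
  case (Suc i)
  then show ?case
    unfolding sin_quot_rec[of "Suc i"] by (simp add: sin_quot_rec[of i] algebra_simps)
qed simp

lemma hecke_lambda_ge_1: "1 \<le> hecke_lambda q"
  using sin_quot_ge_1[of 2] sin_quot_rec[of 0] q3 by (simp add: numeral_2_eq_2)

lemma hecke_lambda_less_2: "hecke_lambda q < 2"
proof -
  have "cos (pi / real q) < cos 0" using q3 by (intro cos_monotone_0_pi) (auto simp: field_simps)
  then show ?thesis by (simp add: hecke_lambda_def)
qed

text \<open>The exponent starts at 1 because the lower right entry of the zeroth power would involve
  the index -1.\<close>

lemma U_pow_eq: "U_pow q (Suc i) = mat2 (sin_quot q (Suc (Suc i))) (- sin_quot q (Suc i)) (sin_quot q (Suc i)) (- sin_quot q i)"
proof (induction i)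
  case 0
  then show ?case
    by (simp add: U_pow_def mat2_one mat2_mult U_mat_def mat2_eq_iff sin_quot_rec)
next
  case (Suc i)
  have "U_pow q (Suc (Suc i)) = U_mat q ** U_pow q (Suc i)" by (simp add: U_pow_def)
  then show ?case
    unfolding Suc by (simp add: mat2_mult U_mat_def mat2_eq_iff sin_quot_rec)
qed

lemma xw_eq [simp]: "xw q i = sin_quot q (Suc i)" and yw_eq [simp]: "yw q i = sin_quot q i"
  by (cases i; simp add: xw_def yw_def w_vec_def U_pow_eq matrix_vector_mult_def sum_2;
      simp add: U_pow_def mat_def)+

lemma M_mat_eq:
  "M_mat q i = mat2 (sin_quot q (Suc i)) (sin_quot q (Suc (Suc i))) (sin_quot q i) (sin_quot q (Suc i))"
  by (cases i; simp add: M_mat_def T_mat_def U_pow_eq mat2_mult mat2_eq_iff sin_quot_rec algebra_simps;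
      simp add: U_pow_def mat2_one mat2_mult mat2_eq_iff)

end


section \<open>The partition and the Farey extension\<close>

context
  fixes q :: nat
  assumes q3: "q \<ge> 3"
begin

section \<open>Cells as cones and as intervals\<close>

lemmas sq_simps = sin_quot_simps[OF q3] xw_eq[OF q3] yw_eq[OF q3]

text \<open>The two conditions say that the inverse of \<open>M_mat q i\<close> sends
  \<open>(a, b)\<close> to a vector with positive first and nonnegative second coordinate: the cell
  is a half-open cone between two consecutive vectors \<open>w_vec\<close>.\<close>

lemma I_set_iff_homogeneous:
  assumes i: "i \<le> q - 2" and ab: "0 < a + b"
  shows "a / (a + b) \<in> I_set q i \<longleftrightarrow>
    sin_quot q (Suc (Suc i)) * b < sin_quot q (Suc i) * a \<and> sin_quot q i * a \<le> sin_quot q (Suc i) * b"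
proof -
  let ?x = "sin_quot q (Suc (Suc i))" and ?y = "sin_quot q (Suc i)" and ?z = "sin_quot q i"
  have "1 \<le> ?y" "0 \<le> ?x" "0 \<le> ?z"
    using i q3 by (auto intro!: sin_quot_ge_1 sin_quot_ge_0)
  then have "0 < ?x + ?y" "0 < ?y + ?z" by auto
  then have "?x / (?x + ?y) < a / (a + b) \<longleftrightarrow> ?x * b < ?y * a" "a / (a + b) \<le> ?y / (?y + ?z) \<longleftrightarrow> ?z * a \<le> ?y * b"
    using ab by (auto simp: field_simps)
  then show ?thesis
    by (simp add: I_set_def sq_simps)
qed

lemma I_set_iff:
  assumes "i \<le> q - 2"
  shows "a \<in> I_set q i \<longleftrightarrow>
    sin_quot q (Suc (Suc i)) * (1 - a) < sin_quot q (Suc i) * a \<and> sin_quot q i * a \<le> sin_quot q (Suc i) * (1 - a)"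
  using I_set_iff_homogeneous[OF assms, of a "1 - a"] by simp

lemma I_set_0: "I_set q 0 = {hecke_lambda q / (hecke_lambda q + 1) <.. 1}"
  using sin_quot_rec[OF q3, of 0] by (simp add: I_set_def sq_simps)

lemma I_set_last: "I_set q (q - 2) = {0 <.. 1 / (hecke_lambda q + 1)}"
proof -
  have q: "Suc (q - 2) = q - 1" "Suc (q - 1) = q" using q3 by auto
  have "sin_quot q (q - 2) = hecke_lambda q" "sin_quot q (q - 1) = 1" "sin_quot q q = 0"
    using sin_quot_reflect[OF q3, of 2] sin_quot_reflect[OF q3, of 1] sin_quot_reflect[OF q3, of 0]
      q3 sin_quot_rec[OF q3, of 0] by (auto simp: numeral_2_eq_2 sq_simps)
  then show ?thesis
    unfolding I_set_def Suc_eq_plus1[symmetric] by (simp add: sq_simps(3,4) q add.commute del: One_nat_def)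
qed

text \<open>The point where the ray through \<open>w_vec q i\<close> meets the line on which the
  coordinates sum to 1.\<close>

definition cut :: "nat \<Rightarrow> real" where
  "cut i = sin_quot q (Suc i) / (sin_quot q (Suc i) + sin_quot q i)"

lemma I_set_cut: "I_set q i = {cut (Suc i) <.. cut i}"
  by (simp add: I_set_def sq_simps cut_def)

text \<open>After cross multiplication the two sides differ by the determinant of
  \<open>M_mat q i\<close>, which is 1.\<close>

lemma cut_less: "i \<le> q - 2 \<Longrightarrow> cut (Suc i) < cut i"
proof -
  assume i: "i \<le> q - 2"
  let ?x = "sin_quot q (Suc (Suc i))" and ?y = "sin_quot q (Suc i)" and ?z = "sin_quot q i"
  have "1 \<le> ?y" "0 \<le> ?z" "0 \<le> ?x"
    using i q3 by (auto intro!: sin_quot_ge_1 sin_quot_ge_0)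
  then have "0 < ?x + ?y" "0 < ?y + ?z" by auto
  moreover have "?x * (?y + ?z) < ?y * (?x + ?y)"
    using sin_quot_det[OF q3, of i] by (simp add: algebra_simps)
  ultimately show ?thesis
    unfolding cut_def by (simp add: divide_simps)
qed

lemma cut_antimono: "i \<le> j \<Longrightarrow> j \<le> q - 1 \<Longrightarrow> cut j \<le> cut i"
proof (induction j rule: dec_induct)
  case (step n)
  then have "cut (Suc n) < cut n" by (intro cut_less) auto
  with step show ?case by auto
qed simp

lemma cut_0: "cut 0 = 1" and cut_last: "cut (q - 1) = 0"
  using sin_quot_reflect[OF q3, of 0] q3 by (auto simp: cut_def sq_simps)

lemma I_set_subset: "i \<le> q - 2 \<Longrightarrow> I_set q i \<subseteq> {0<..1}"
proof -
  assume i: "i \<le> q - 2"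
  have "cut i \<le> cut 0" "cut (q - 1) \<le> cut (Suc i)"
    using i q3 by (auto intro!: cut_antimono)
  then show ?thesis
    by (auto simp: I_set_cut cut_0 cut_last[unfolded One_nat_def])
qed

lemma I_set_disjoint:
  assumes "i \<le> q - 2" "j \<le> q - 2" "a \<in> I_set q i" "a \<in> I_set q j"
  shows "i = j"
proof -
  have *: False if "i < j" "j \<le> q - 2" "a \<in> I_set q i" "a \<in> I_set q j" for i j
  proof -
    have "cut j \<le> cut (Suc i)" using that q3 by (intro cut_antimono) auto
    with that show ?thesis by (auto simp: I_set_cut)
  qed
  show ?thesis
    using *[of i j] *[of j i] assms by (metis linorder_neqE_nat)
qed

lemma I_set_cover:
  assumes "a \<in> {0<..1}"
  obtains i where "i \<le> q - 2" "a \<in> I_set q i"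
proof -
  have ex: "cut (q - 1) < a" using assms by (simp only: cut_last) auto
  \<comment> \<open>The cell is the predecessor of this \<open>n\<close>: minimality gives
    \<open>a \<le> cut (n - 1)\<close>, and \<open>n\<close> is positive because
    \<open>cut 0 = 1\<close>.\<close>
  define n where "n = (LEAST n. cut n < a)"
  have 1: "cut n < a"
    unfolding n_def using ex by (rule LeastI)
  have 2: "n \<le> q - 1"
    unfolding n_def using ex by (rule Least_le)
  have 3: "n \<noteq> 0" using 1 assms by (auto simp: cut_0 intro: Nat.gr0I)
  then have 4: "\<not> cut (n - 1) < a" using not_less_Least[of "n - 1" "\<lambda>n. cut n < a"] by (auto simp: n_def)
  show ?thesis
    by (rule that[of "n - 1"]) (use 1 2 3 4 in \<open>auto simp: I_set_cut\<close>)
qed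

section \<open>Explicit formulas on a single cell\<close>

lemma cell_index_eq: "i \<le> q - 2 \<Longrightarrow> a \<in> I_set q i \<Longrightarrow> cell_index q a = i"
  unfolding cell_index_def by (rule the_equality) (auto dest: I_set_disjoint)

lemma cell_index:
  assumes "a \<in> {0<..1}"
  shows "cell_index q a \<le> q - 2" "a \<in> I_set q (cell_index q a)"
  using I_set_cover[OF assms] cell_index_eq by metis+

text \<open>The summands are the coordinates of the inverse of \<open>M_mat q i\<close> applied to
  \<open>(a, 1 - a)\<close>, so division by \<open>rho\<close> puts the image back on the line of
  coordinate sum 1.\<close>

lemma rho_eq:
  "rho q i a = (sin_quot q (Suc i) * a - sin_quot q (Suc (Suc i)) * (1 - a)) +
     (sin_quot q (Suc i) * (1 - a) - sin_quot q i * a)"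
  by (simp add: rho_def sq_simps algebra_simps)

lemma rho_pos: "i \<le> q - 2 \<Longrightarrow> a \<in> I_set q i \<Longrightarrow> 0 < rho q i a"
  by (simp add: rho_eq I_set_iff)

lemma farey_eq:
  assumes "i \<le> q - 2" "a \<in> I_set q i"
  shows "farey q a = (sin_quot q (Suc i) * a - sin_quot q (Suc (Suc i)) * (1 - a)) / rho q i a"
  by (simp add: farey_def cell_index_eq[OF assms] rho_def sq_simps algebra_simps)

text \<open>The left column of the matrix equation consists of \<open>a'\<close> and
  \<open>- s' * a'\<close> and determines the point. The upper right entry then agrees by the choice
  of \<open>rho\<close>, and the lower right one because both sides have determinant 1.\<close>

lemma farey_ext_eq:
  assumes i: "i \<le> q - 2" "a \<in> I_set q i" and S: "(a, s) \<in> S_set"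
  shows "farey_ext q (a, s) = (farey q a, (rho q i a)\<^sup>2 * s + (rho q i a)\<^sup>2 * sin_quot q (Suc (Suc i)) /
           (a * (sin_quot q (Suc i) * a - sin_quot q (Suc (Suc i)) * (1 - a))))" (is "_ = (?a', ?s')")
    and "farey_ext q (a, s) \<in> S_set"
proof -
  define x' y' x y where xy: "x' = sin_quot q (Suc (Suc i))" "y' = sin_quot q (Suc i)" "x = sin_quot q (Suc i)" "y = sin_quot q i"
  define b \<rho> \<alpha> \<beta> p r where d: "b = 1 - a" "\<rho> = rho q i a" "\<alpha> = y' * a - x' * b" "\<beta> = x * b - y * a" "p = s * a" "r = 1 / a - s * b"
  have det: "x * y' - x' * y = 1" using sin_quot_det[OF q3, of i] by (simp add: xy)
  have sgn: "0 \<le> x'" "1 \<le> y'" "1 \<le> x" "0 \<le> y"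
    using i q3 by (auto simp: xy intro!: sin_quot_ge_1[OF q3] sin_quot_ge_0[OF q3])
  have ab: "0 < \<alpha>" "0 \<le> \<beta>" "\<rho> = \<alpha> + \<beta>" "0 < \<rho>"
    using i by (auto simp: d xy rho_eq I_set_iff rho_pos)
  have pr: "0 < a" "0 \<le> b" "0 \<le> p" "0 < r" 
    using S_set_pt[OF S] by (auto simp: d)
  have D: "a * r + b * p = 1" using pr by (simp add: d field_simps)
  define p' r' where "p' = y' * p + x' * r" and "r' = y * p + x * r"
  have pos': "0 \<le> p'" "0 < r'"
    using sgn pr by (auto simp: p'_def r'_def intro!: add_nonneg_pos)
  have "\<alpha> * r' + \<beta> * p' = (x * y' - x' * y) * (a * r + b * p)"
    by (simp add: d(3,4) p'_def r'_def algebra_simps)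
  then have D': "\<alpha> * r' + \<beta> * p' = 1" by (simp add: det D)
  \<comment> \<open>Trading \<open>r\<close> for the pairing, which is 1, makes the new second
    coordinate an affine function of \<open>s\<close>.\<close>
  have "a * p' = p * \<alpha> + x' * (a * r + b * p)"
    by (simp add: d(3) p'_def algebra_simps)
  then have s1: "a * p' = p * \<alpha> + x'" by (simp add: D)
  have a': "?a' = \<alpha> / \<rho>" using farey_eq[OF i] by (simp add: d xy)
  have s': "?s' = \<rho>\<^sup>2 * p' / \<alpha>"
  proof -
    have "?s' = \<rho>\<^sup>2 * (p * \<alpha> + x') / (a * \<alpha>)"
      using pr(1) ab(1,4) unfolding xy[symmetric] d(1)[symmetric] d(2)[symmetric] d(3)[symmetric] by (simp add: d(5) field_simps)
    also have "\<dots> = \<rho>\<^sup>2 * p' / \<alpha>"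
      using pr ab by (simp add: s1[symmetric])
    finally show ?thesis .
  qed
  have pt': "(?a', ?s') = pt \<alpha> \<beta> p' r'"
    unfolding pt_def D' a' s' by (simp add: ab)
  have inS: "(?a', ?s') \<in> S_set"
    unfolding pt' using pos' ab by (intro pt_in_S) auto
  have "g_diag (- ln (rho q i a)) = mat2 (1 / \<rho>) 0 0 \<rho>"
    using ab by (simp add: g_diag_def d(2)[symmetric] exp_minus inverse_eq_divide)
  moreover have "transpose (matrix_inv (M_mat q i)) = mat2 y' (- y) (- x') x"
    unfolding M_mat_eq[OF q3] xy[symmetric] using det
    by (subst mat2_inv) (auto simp: mat2_transpose xy)
  moreover have hg: "h_mat s ** g_upper a (1 - a) = mat2 a b (- p) r"
    by (simp add: h_mat_def g_upper_def mat2_mult mat2_eq_iff d(1,5,6) inverse_eq_divide)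
  ultimately have rhs: "g_diag (- ln (rho q i a)) ** h_mat s ** g_upper a (1 - a) ** transpose (matrix_inv (M_mat q i))
      = mat2 (\<alpha> / \<rho>) (\<beta> / \<rho>) (- \<rho> * p') (\<rho> * r')"
    unfolding matrix_mul_assoc[symmetric, of _ "h_mat s" "g_upper a (1 - a)"]
    by (simp add: mat2_mult mat2_eq_iff d(3,4) p'_def r'_def diff_divide_distrib algebra_simps)
  have "farey_ext q (a, s) = (THE (a', s'). (a', s') \<in> S_set \<and> h_mat s' ** g_upper a' (1 - a') =
      mat2 (\<alpha> / \<rho>) (\<beta> / \<rho>) (- \<rho> * p') (\<rho> * r'))"
    by (simp only: farey_ext_def prod.case Let_def cell_index_eq[OF i] rhs)
  also have "\<dots> = (?a', ?s')"
  proof (rule the_equality, goal_cases)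
    case 1
    have "1 - \<alpha> / \<rho> = \<beta> / \<rho>" using ab by (simp add: field_simps)
    moreover have "\<rho>\<^sup>2 * p' / \<alpha> * (\<alpha> / \<rho>) = \<rho> * p'"
      using ab(1,4) by (simp add: power2_eq_square)
    moreover have "\<rho> / \<alpha> - \<rho>\<^sup>2 * p' / \<alpha> * (\<beta> / \<rho>) = \<rho> * r'"
    proof -
      have "\<rho> / \<alpha> - \<rho>\<^sup>2 * p' / \<alpha> * (\<beta> / \<rho>) = \<rho> * (1 - \<beta> * p') / \<alpha>"
        using ab(1,4) by (simp add: power2_eq_square field_simps)
      also have "1 - \<beta> * p' = \<alpha> * r'" using D' by simp
      finally show ?thesis using ab(1) by simp
    qed
    ultimately show ?case
      using inS by (simp add: a' s' h_mat_def g_upper_def mat2_mult mat2_eq_iff)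
  next
    case (2 z)
    obtain a1 s1 where z: "z = (a1, s1)" by force
    with 2 have "a1 = \<alpha> / \<rho>" "s1 * a1 = \<rho> * p'"
      by (auto simp: h_mat_def g_upper_def mat2_mult mat2_eq_iff)
    then show ?case
      unfolding z a' s' using ab(1,4) by (auto simp: field_simps power2_eq_square)
  qed
  finally show "farey_ext q (a, s) = (?a', ?s')" .
  with inS show "farey_ext q (a, s) \<in> S_set" by simp
qed

end


section \<open>Reversibility of the Farey extension\<close>

context
  fixes q :: nat
  assumes q3: "q \<ge> 3"
begin

abbreviation (input) sq :: "nat \<Rightarrow> real" where "sq \<equiv> sin_quot q"

lemma sin_quot_signs:
  assumes "i \<le> q - 2"
  shows "1 \<le> sq (Suc i)" "0 \<le> sq i" "0 \<le> sq (Suc (Suc i))"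
  using assms q3 by (auto intro!: sin_quot_ge_1[OF q3] sin_quot_ge_0[OF q3])

text \<open>Entry by entry this says that \<open>M_mat q (q - 2 - i)\<close> is the transpose of
  \<open>M_mat q i\<close>.\<close>

lemma sin_quot_dual:
  assumes "i \<le> q - 2"
  shows "sq (q - 2 - i) = sq (Suc (Suc i))" "sq (Suc (q - 2 - i)) = sq (Suc i)"
    "sq (Suc (Suc (q - 2 - i))) = sq i"
proof -
  have "q - 2 - i = q - Suc (Suc i)" "Suc (q - 2 - i) = q - Suc i" "Suc (Suc (q - 2 - i)) = q - i"
    using assms q3 by auto
  then show "sq (q - 2 - i) = sq (Suc (Suc i))" "sq (Suc (q - 2 - i)) = sq (Suc i)"
    "sq (Suc (Suc (q - 2 - i))) = sq i"
    using assms q3 by (simp_all only:) (auto intro!: sin_quot_reflect[OF q3])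
qed

lemma fst_pt_in_I_set:
  assumes "i \<le> q - 2" "0 < a" "0 \<le> b"
  shows "fst (pt a b p r) \<in> I_set q i \<longleftrightarrow> sq (Suc (Suc i)) * b < sq (Suc i) * a \<and> sq i * a \<le> sq (Suc i) * b"
  using I_set_iff_homogeneous[OF q3 assms(1), of a b] assms by (simp add: pt_def)

text \<open>For a normalized pair, with \<open>a + b = 1\<close> and
  \<open>a * r + b * p = 1\<close>, this is the formula for a point \<open>(a, s)\<close>; by
  homogeneity of \<open>pt\<close> every other pair reduces to that case.\<close>

lemma farey_ext_pt:
  assumes i: "i \<le> q - 2" and pos: "0 < a" "0 \<le> b" "0 \<le> p" "0 < r"
    and V: "sq (Suc (Suc i)) * b < sq (Suc i) * a" "sq i * a \<le> sq (Suc i) * b"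
  shows "farey_ext q (pt a b p r) = pt (sq (Suc i) * a - sq (Suc (Suc i)) * b) (sq (Suc i) * b - sq i * a)
    (sq (Suc i) * p + sq (Suc (Suc i)) * r) (sq i * p + sq (Suc i) * r)"
proof -
  define x y z where xyz: "x = sq (Suc (Suc i))" "y = sq (Suc i)" "z = sq i"
  have det: "y * y - x * z = 1" using sin_quot_det[OF q3, of i] by (simp add: xyz)
  have sgn: "0 \<le> x" "1 \<le> y" "0 \<le> z"
    using sin_quot_signs[OF i] by (auto simp: xyz)
  have *: "farey_ext q (pt a b p r) = pt (y * a - x * b) (y * b - z * a) (y * p + x * r) (z * p + y * r)"
    if ab: "a + b = 1" and D: "a * r + b * p = 1" and pos: "0 < a" "0 \<le> b" "0 \<le> p" "0 < r"
      and V: "x * b < y * a" "z * a \<le> y * b" for a b p r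
  proof -
    have aI: "a \<in> I_set q i"
      using V ab by (simp add: I_set_iff[OF q3 i] xyz[symmetric] eq_diff_eq[symmetric])
    define \<alpha> \<beta> \<rho> where d: "\<alpha> = y * a - x * b" "\<beta> = y * b - z * a" "\<rho> = rho q i a"
    have b: "1 - a = b" using ab by simp
    have \<rho>: "\<rho> = \<alpha> + \<beta>" by (simp add: d rho_eq[OF q3] xyz b)
    have pt: "pt a b p r = (a, p / a)" by (simp add: pt_def ab D)
    have "(a, p / a) \<in> S_set" unfolding pt[symmetric] using pos by (rule pt_in_S)
    from farey_ext_eq(1)[OF q3 i aI this] farey_eq[OF q3 i aI]
    have F: "farey_ext q (pt a b p r) = (\<alpha> / \<rho>, \<rho>\<^sup>2 * (p / a) + \<rho>\<^sup>2 * x / (a * \<alpha>))"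
      by (simp add: pt d xyz b)
    have "\<alpha> * (z * p + y * r) + \<beta> * (y * p + x * r) = (y * y - x * z) * (a * r + b * p)"
      by (simp add: d(1,2) algebra_simps)
    then have D': "\<alpha> * (z * p + y * r) + \<beta> * (y * p + x * r) = 1" by (simp add: det D)
    have "a * (y * p + x * r) = p * \<alpha> + x * (a * r + b * p)"
      by (simp add: d(1) algebra_simps)
    then have s1: "p * \<alpha> + x = a * (y * p + x * r)" by (simp add: D)
    have "0 < \<alpha>" using V by (simp add: d)
    then have "\<rho>\<^sup>2 * (p / a) + \<rho>\<^sup>2 * x / (a * \<alpha>) = \<rho>\<^sup>2 * (p * \<alpha> + x) / (a * \<alpha>)"
      using pos(1) by (simp add: field_simps)
    also have "\<dots> = \<rho>\<^sup>2 * (y * p + x * r) / \<alpha>"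
      unfolding s1 using pos(1) by simp
    finally show ?thesis
      unfolding F
      unfolding pt_def d(1)[symmetric] d(2)[symmetric] D' \<rho>[symmetric] by simp
  qed
  \<comment> \<open>\<open>k\<close> normalizes the sum \<open>a + b\<close>; \<open>l\<close> is
    then forced by the requirement that the pairing become 1.\<close>
  define k l where kl: "k = 1 / (a + b)" "l = (a + b) / (a * r + b * p)"
  have D: "0 < a * r + b * p" using pos by (intro add_pos_nonneg) auto
  then have kl0: "0 < k" "0 < l" using pos by (auto simp: kl intro!: divide_pos_pos add_pos_nonneg)
  have n1: "k * a + k * b = 1" using pos by (simp add: kl add_divide_distrib[symmetric])
  have "k * a * (l * r) + k * b * (l * p) = (k * l) * (a * r + b * p)" by (simp add: algebra_simps)
  then have n2: "k * a * (l * r) + k * b * (l * p) = 1" using D pos by (simp add: kl)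
  have V': "x * b < y * a" "z * a \<le> y * b" using V by (auto simp: xyz)
  have "farey_ext q (pt a b p r) = farey_ext q (pt (k * a) (k * b) (l * p) (l * r))"
    using pos kl0 by (simp add: pt_scale)
  also have "\<dots> = pt (y * (k * a) - x * (k * b)) (y * (k * b) - z * (k * a)) (y * (l * p) + x * (l * r)) (z * (l * p) + y * (l * r))"
  proof (rule *[OF n1 n2])
    show "x * (k * b) < y * (k * a)" "z * (k * a) \<le> y * (k * b)"
      using V' kl0(1) by (simp_all add: mult.left_commute[of _ k])
  qed (use pos kl0 in auto)
  also have "\<dots> = pt (k * (y * a - x * b)) (k * (y * b - z * a)) (l * (y * p + x * r)) (l * (z * p + y * r))"
    by (simp add: algebra_simps)
  also have "\<dots> = pt (y * a - x * b) (y * b - z * a) (y * p + x * r) (z * p + y * r)"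
    using V' kl0 pos sgn by (intro pt_scale) (auto intro: add_nonneg_pos)
  finally show ?thesis by (simp only: xyz)
qed

lemma S_set_fst: "z \<in> S_set \<Longrightarrow> fst z \<in> {0<..1}"
  by (cases z) (auto simp: S_set_iff)

lemma farey_ext_in_S: "z \<in> S_set \<Longrightarrow> farey_ext q z \<in> S_set"
  using farey_ext_eq(2)[OF q3 cell_index[OF q3]] S_set_fst[of z] by (cases z) auto

lemma fst_farey_ext: "z \<in> S_set \<Longrightarrow> fst (farey_ext q z) = farey q (fst z)"
  using farey_ext_eq(1)[OF q3 cell_index[OF q3]] S_set_fst[of z] by (cases z) auto

text \<open>Reversibility of the extension: \<open>flip\<close> exchanges \<open>V_set\<close> and \<open>H_set\<close>, and the matrix
  acting on \<open>(r, p)\<close> in the cell \<open>i\<close> is the inverse of the one acting on \<open>(a, b)\<close> in the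
  cell \<open>q - 2 - i\<close>, because \<open>M_mat q (q - 2 - i)\<close> is the transpose of \<open>M_mat q i\<close>.\<close>

lemma farey_ext_reversible:
  assumes z: "z \<in> S_set" and i: "i \<le> q - 2" "fst z \<in> I_set q i"
  shows "fst (flip (farey_ext q z)) \<in> I_set q (q - 2 - i)"
    and "farey_ext q (flip (farey_ext q z)) = flip z"
proof -
  obtain a b p r where zpt: "z = pt a b p r" and pos: "0 < a" "0 \<le> b" "0 \<le> p" "0 < r"
    using S_set_cases[OF z] .
  define x y z' where xyz: "x = sq (Suc (Suc i))" "y = sq (Suc i)" "z' = sq i"
  have det: "y * y - x * z' = 1" using sin_quot_det[OF q3, of i] by (simp add: xyz)
  have sgn: "0 \<le> x" "1 \<le> y" "0 \<le> z'"
    using sin_quot_signs[OF i(1)] by (auto simp: xyz)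
  have V: "x * b < y * a" "z' * a \<le> y * b"
    using i(2) fst_pt_in_I_set[OF i(1) pos(1,2)] by (auto simp: zpt xyz)
  define a1 b1 p1 r1 where d: "a1 = y * a - x * b" "b1 = y * b - z' * a" "p1 = y * p + x * r" "r1 = z' * p + y * r"
  have pos1: "0 < a1" "0 \<le> b1" "0 \<le> p1" "0 < r1"
    using V sgn pos by (auto simp: d intro!: add_nonneg_pos)
  have F: "farey_ext q z = pt a1 b1 p1 r1"
    using farey_ext_pt[OF i(1) pos] V by (simp add: d zpt xyz)
  have fl: "flip (farey_ext q z) = pt r1 p1 b1 a1"
    unfolding F using pos1 by (rule flip_pt)
  define j where "j = q - 2 - i"
  have j: "j \<le> q - 2" by (simp add: j_def)
  note dual = sin_quot_dual[OF i(1), folded xyz j_def]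
  have inv: "y * r1 - z' * p1 = r" "y * p1 - x * r1 = p" "y * b1 + z' * a1 = b" "x * b1 + y * a1 = a"
  proof -
    have "y * r1 - z' * p1 = (y * y - x * z') * r" "y * p1 - x * r1 = (y * y - x * z') * p"
      "y * b1 + z' * a1 = (y * y - x * z') * b" "x * b1 + y * a1 = (y * y - x * z') * a"
      by (simp_all add: d algebra_simps)
    then show "y * r1 - z' * p1 = r" "y * p1 - x * r1 = p" "y * b1 + z' * a1 = b" "x * b1 + y * a1 = a"
      by (simp_all add: det)
  qed
  have V1: "z' * p1 < y * r1" "x * r1 \<le> y * p1"
    using inv pos by linarith+
  show "fst (flip (farey_ext q z)) \<in> I_set q (q - 2 - i)"
    unfolding fl j_def[symmetric] using pos1 V1 by (subst fst_pt_in_I_set[OF j]) (auto simp: dual)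
  have "farey_ext q (flip (farey_ext q z)) = pt r p b a"
    unfolding fl using farey_ext_pt[OF j pos1(4,3,2,1)] V1 by (simp add: dual inv)
  then show "farey_ext q (flip (farey_ext q z)) = flip z"
    using pos by (simp add: zpt flip_pt)
qed

lemma farey_ext_flip_farey_ext: "z \<in> S_set \<Longrightarrow> farey_ext q (flip (farey_ext q z)) = flip z"
  using farey_ext_reversible(2) cell_index[OF q3 S_set_fst] by blast

text \<open>The denominator of \<open>R_fun\<close> vanishes only for \<open>i = q - 1\<close> and
  \<open>a = 1\<close>. There \<open>R_fun\<close> is infinite, while the right-hand side reads
  \<open>sq i \<le> 0\<close> with \<open>sq i\<close> positive, so both sides fail.\<close>

lemma R_fun_le_iff:
  assumes "i \<le> q - 1" "(a, s) \<in> S_set"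
  shows "R_fun q i a (1 - a) \<le> ereal s \<longleftrightarrow> sq i \<le> s * a * (sq (Suc i) * a + sq i * (1 - a))"
proof -
  have 0: "0 < a" "a \<le> 1" "0 \<le> s" using assms(2) by (auto simp: S_set_iff)
  have *: "0 \<le> sq i" "0 \<le> sq (Suc i)" using assms q3 by (auto intro!: sin_quot_ge_0[OF q3])
  define D where "D = sq (Suc i) * a + sq i * (1 - a)"
  have "0 \<le> D" using 0 * by (simp add: D_def)
  show ?thesis
  proof (cases "D = 0")
    case False
    then have "0 < a * D" using 0 \<open>0 \<le> D\<close> by simp
    moreover have "R_fun q i a (1 - a) = ereal (sq i / (a * D))"
      using False 0(1) unfolding R_fun_def by (simp add: sq_simps[OF q3] flip: D_def)
    ultimately show ?thesis
      by (simp add: D_def[symmetric] pos_divide_le_eq mult.assoc)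
  next
    case True
    then have "sq (Suc i) * a = 0" "sq i * (1 - a) = 0"
      using 0 * by (auto simp: D_def add_nonneg_eq_0_iff)
    moreover have "i = 0 \<or> 1 \<le> sq i"
      using sin_quot_ge_1[OF q3, of i] assms(1) q3 by linarith
    ultimately have "0 < sq i" using 0 * by (auto simp: sq_simps[OF q3])
    then show ?thesis
      using True unfolding R_fun_def by (simp add: sq_simps[OF q3] D_def[symmetric])
  qed
qed

text \<open>Since \<open>a * r + (1 - a) * p = 1\<close>, the bounds of the strip turn into the cone
  inequalities of the cell \<open>i\<close> for \<open>(r, p)\<close>, the first direction of
  \<open>flip z\<close>.\<close>

lemma H_set_iff:
  assumes i: "i \<le> q - 2" and z: "z \<in> S_set"
  shows "z \<in> H_set q i \<longleftrightarrow> fst (flip z) \<in> I_set q i"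
proof -
  obtain a s where as: "z = (a, s)" by force
  note S = z[unfolded as]
  note pos = S_set_pt[OF S]
  define p r where pr: "p = s * a" "r = 1 / a - s * (1 - a)"
  have e: "s * a * (x * a + y * (1 - a)) = y + a * (x * p - y * r)" for x y
    using pos(2) by (simp add: pr field_simps)
  have H: "z \<in> H_set q i \<longleftrightarrow> sq i * r \<le> sq (Suc i) * p \<and> sq (Suc (Suc i)) * p < sq (Suc i) * r"
    using R_fun_le_iff[OF _ S, of i] R_fun_le_iff[OF _ S, of "Suc i"] i q3 S pos(2)
    unfolding e not_le[symmetric] by (auto simp: as H_set_def zero_le_mult_iff not_le[symmetric])
  have "flip z = pt r p (1 - a) a"
    by (simp add: as flip_def pr)
  with H show ?thesis
    using fst_pt_in_I_set[OF i, of r p "1 - a" a] pos by (auto simp: pr)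
qed

lemma V_set_iff: "z \<in> S_set \<Longrightarrow> z \<in> V_set q i \<longleftrightarrow> fst z \<in> I_set q i"
  by (cases z) (auto simp: V_set_def)

lemma R_set_iff:
  "z \<in> R_set q \<longleftrightarrow> z \<in> S_set \<and> \<not> (fst z \<in> I_set q (q - 2) \<and> fst (flip z) \<in> I_set q 0)
     \<and> \<not> (fst z \<in> I_set q 0 \<and> fst (flip z) \<in> I_set q (q - 2))"
  using H_set_iff[of 0 z] H_set_iff[of "q - 2" z] V_set_iff[of z] by (auto simp: R_set_def)

lemma flip_in_R: "z \<in> R_set q \<Longrightarrow> flip z \<in> R_set q"
  by (auto simp: R_set_iff flip_in_S flip_flip)

end


section \<open>Return times and contraction of fibres\<close>

text \<open>The number of Farey steps taken by \<open>gauss\<close>. It is 0 at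
  \<open>a = 1\<close>, by the default of \<open>exit_time\<close>, and positive elsewhere in the
  half-open unit interval.\<close>

definition return_time :: "nat \<Rightarrow> real \<Rightarrow> nat" where
  "return_time q a =
    (if a \<in> I_set q 0 then exit_time q 0 a
     else if a \<in> I_set q (q - 2) then exit_time q (q - 2) a else 1)"

lemma gauss_eq: "gauss q a = (farey q ^^ return_time q a) a"
  by (simp add: gauss_def return_time_def)

lemma gauss_ext_eq: "gauss_ext q z = (farey_ext q ^^ return_time q (fst z)) z"
  by (cases z) (simp add: gauss_ext_def return_time_def)

text \<open>A nonnegative potential cannot drop by at least 1 at every step forever.\<close>

lemma ex_iterate_leaves:
  fixes \<Phi> :: "'a \<Rightarrow> real"
  assumes "\<And>x. x \<in> A \<Longrightarrow> 0 \<le> \<Phi> x"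
    and "\<And>x. x \<in> A \<Longrightarrow> f x \<in> A \<Longrightarrow> \<Phi> (f x) \<le> \<Phi> x - 1"
  shows "\<exists>n. (f ^^ n) x \<notin> A"
proof (rule ccontr)
  assume "\<not> ?thesis"
  then have A: "(f ^^ n) x \<in> A" for n by blast
  have "\<Phi> ((f ^^ n) x) \<le> \<Phi> x - real n" for n
  proof (induction n)
    case (Suc n)
    then show ?case using assms(2)[OF A[of n]] A[of "Suc n"] by simp
  qed simp
  moreover obtain n where "\<Phi> x < real n" using reals_Archimedean2 by blast
  ultimately show False using assms(1)[OF A, of n] by (smt (verit))
qed

text \<open>The backward orbit of \<open>z\<close> is the flipped forward orbit of \<open>flip z\<close>, and \<open>flip\<close> exchanges the
  lines \<open>a = 1\<close> and \<open>s = 0\<close>; so neither line meets the two-sided orbit of a point of this set.\<close>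

definition regular_set :: "nat \<Rightarrow> (real \<times> real) set" where
  "regular_set q = {z \<in> S_set. \<forall>n. fst ((farey_ext q ^^ n) z) < 1 \<and> fst ((farey_ext q ^^ n) (flip z)) < 1}"

abbreviation (input) core_set :: "nat \<Rightarrow> (real \<times> real) set" where
  "core_set q \<equiv> R_set q \<inter> regular_set q"

text \<open>The multiplicative cocycle of \<open>rho\<close> over \<open>farey\<close>; its square
  is the slope of the \<open>k\<close>-th iterate of the extension along the fibre over
  \<open>a\<close>.\<close>

fun rho_prod :: "nat \<Rightarrow> nat \<Rightarrow> real \<Rightarrow> real" where
  "rho_prod q 0 a = 1"
| "rho_prod q (Suc k) a = rho q (cell_index q a) a * rho_prod q k (farey q a)"

context
  fixes q :: nat
  assumes q3: "q \<ge> 3"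
begin

lemma iterate_farey_ext:
  assumes "z \<in> S_set"
  shows "(farey_ext q ^^ n) z \<in> S_set" "fst ((farey_ext q ^^ n) z) = (farey q ^^ n) (fst z)"
proof (induction n)
  case (Suc n)
  { case 1 show ?case using Suc farey_ext_in_S[OF q3] by simp }
  { case 2 show ?case using Suc fst_farey_ext[OF q3] by simp }
qed (use assms in auto)

lemma farey_range: "a \<in> {0<..1} \<Longrightarrow> farey q a \<in> {0<..1}"
proof -
  assume "a \<in> {0<..1}"
  then have "(a, 0) \<in> S_set" by (auto simp: S_set_iff)
  then show ?thesis using fst_farey_ext[OF q3] S_set_fst[OF q3 farey_ext_in_S[OF q3]] by fastforce
qed

lemma iterate_farey_range: "a \<in> {0<..1} \<Longrightarrow> (farey q ^^ n) a \<in> {0<..1}"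
  by (induction n) (auto dest: farey_range simp del: greaterThanAtMost_iff)

lemma first_last_distinct: "a \<in> I_set q 0 \<Longrightarrow> a \<notin> I_set q (q - 2)"
  using I_set_disjoint[OF q3, of 0 "q - 2" a] q3 by auto

text \<open>The matrix of cell 0 is \<open>T_mat q\<close>, whose inverse translates the ratio of
  the coordinates by \<open>- hecke_lambda q\<close>.\<close>

lemma farey_first:
  assumes "a \<in> I_set q 0" "a < 1"
  shows "farey q a < 1" "farey q a / (1 - farey q a) = a / (1 - a) - hecke_lambda q"
proof -
  have \<rho>: "0 < rho q 0 a" "rho q 0 a = 1 - hecke_lambda q * (1 - a)"
    using rho_pos[OF q3 _ assms(1)] by (simp_all add: rho_eq[OF q3] sq_simps[OF q3] sin_quot_rec[OF q3])
  have f: "farey q a = (a - hecke_lambda q * (1 - a)) / rho q 0 a"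
    using farey_eq[OF q3 _ assms(1)] by (simp add: sq_simps[OF q3] sin_quot_rec[OF q3])
  have g: "1 - farey q a = (1 - a) / rho q 0 a"
    using \<rho> unfolding f by (simp add: field_simps)
  then have "0 < 1 - farey q a" using \<rho> assms by simp
  then show "farey q a < 1" by simp
  show "farey q a / (1 - farey q a) = a / (1 - a) - hecke_lambda q"
    unfolding g unfolding f using \<rho>(1) assms(2) by (simp add: field_simps)
qed

text \<open>The matrix of the cell \<open>q - 2\<close> is the transpose of \<open>T_mat q\<close>,
  so here the reciprocal ratio is translated.\<close>

lemma farey_last:
  assumes "a \<in> I_set q (q - 2)"
  shows "(1 - farey q a) / farey q a = (1 - a) / a - hecke_lambda q"
proof -
  have l: "q - 2 \<le> q - 2" ..
  have a: "0 < a" using I_set_subset[OF q3 l] assms by auto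
  have "sin_quot q (Suc (Suc (q - 2))) = 0" "sin_quot q (Suc (q - 2)) = 1" "sin_quot q (q - 2) = hecke_lambda q"
    using sin_quot_dual[OF q3, of 0] by (auto simp: sq_simps[OF q3] sin_quot_rec[OF q3])
  then have \<rho>: "0 < rho q (q - 2) a" "rho q (q - 2) a = 1 - hecke_lambda q * a"
    and f: "farey q a = a / rho q (q - 2) a"
    using rho_pos[OF q3 l assms] farey_eq[OF q3 l assms] by (simp_all add: rho_eq[OF q3])
  have g: "1 - farey q a = (1 - a - hecke_lambda q * a) / rho q (q - 2) a"
    using \<rho> unfolding f by (simp add: field_simps)
  show ?thesis
    unfolding g unfolding f using \<rho>(1) a by (simp add: field_simps)
qed

lemma farey_1: "1 \<in> I_set q 0" "farey q 1 = 1"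
proof -
  show *: "1 \<in> I_set q 0" by (simp add: I_set_iff[OF q3] sq_simps[OF q3])
  show "farey q 1 = 1" using farey_eq[OF q3 _ *] by (simp add: rho_eq[OF q3] sq_simps[OF q3])
qed

text \<open>With 1 removed from the cell, \<open>a / (1 - a)\<close> is a potential that drops by at
  least 1. A point of the cell below 1 is never mapped to 1, so leaving the punctured cell means
  leaving the cell.\<close>

lemma exit_first:
  assumes "a \<in> I_set q 0" "a < 1"
  shows "\<exists>n. (farey q ^^ n) a \<notin> I_set q 0"
proof -
  let ?A = "I_set q 0 - {1}"
  have lt: "x < 1 \<and> 0 < x" if "x \<in> ?A" for x
    using that I_set_subset[OF q3, of 0] by force
  have ex: "\<exists>n. (farey q ^^ n) a \<notin> ?A"
    by (rule ex_iterate_leaves[of _ "\<lambda>x. x / (1 - x)"])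
       (use lt farey_first(2) hecke_lambda_ge_1[OF q3] in \<open>force+\<close>)
  define n where "n = (LEAST n. (farey q ^^ n) a \<notin> ?A)"
  have n: "(farey q ^^ n) a \<notin> ?A" unfolding n_def using ex by (rule LeastI_ex)
  have "n \<noteq> 0" using n assms by (intro notI) auto
  then obtain m where m: "n = Suc m" by (cases n) auto
  have "(farey q ^^ m) a \<in> ?A" using not_less_Least[of m "\<lambda>n. (farey q ^^ n) a \<notin> ?A"] m by (auto simp: n_def)
  then have "(farey q ^^ n) a < 1" using lt by (auto simp: m intro: farey_first)
  then show ?thesis using n by (intro exI[of _ n]) auto
qed

lemma exit_last:
  assumes "a \<in> I_set q (q - 2)"
  shows "\<exists>n. (farey q ^^ n) a \<notin> I_set q (q - 2)"
proof (rule ex_iterate_leaves[of _ "\<lambda>x. (1 - x) / x"])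
  have "x \<in> {0<..1}" if "x \<in> I_set q (q - 2)" for x
    using that I_set_subset[OF q3, of "q - 2"] by auto
  then show "0 \<le> (1 - x) / x" if "x \<in> I_set q (q - 2)" for x
    using that by fastforce
qed (use farey_last hecke_lambda_ge_1[OF q3] in force)

lemma exit_time_props:
  assumes "a \<in> I_set q i" "\<exists>n. (farey q ^^ n) a \<notin> I_set q i"
  shows "0 < exit_time q i a" "(farey q ^^ exit_time q i a) a \<notin> I_set q i"
    "k < exit_time q i a \<Longrightarrow> (farey q ^^ k) a \<in> I_set q i"
proof -
  have e: "exit_time q i a = (LEAST n. (farey q ^^ n) a \<notin> I_set q i)"
    using assms(2) by (simp add: exit_time_def)
  show *: "(farey q ^^ exit_time q i a) a \<notin> I_set q i"
    unfolding e using assms(2) by (rule LeastI_ex)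
  show "0 < exit_time q i a" using * assms(1) by (intro gr0I) auto
  show "k < exit_time q i a \<Longrightarrow> (farey q ^^ k) a \<in> I_set q i"
    unfolding e using not_less_Least by blast
qed

lemma return_time_1: "return_time q 1 = 0"
proof -
  have "(farey q ^^ n) 1 = 1" for n by (induction n) (auto simp: farey_1)
  then show ?thesis by (simp add: return_time_def exit_time_def farey_1)
qed

text \<open>As long as the orbit stays in an end cell, the flip of each successor lies in the
  opposite end cell, and such pairs of cells are exactly what \<open>R_set\<close> omits. At the
  exit the flip is still there but the point has left its cell, so it belongs to
  \<open>R_set\<close>. From a middle cell the flip of the image lies in a middle cell, and one step
  suffices.\<close>

lemma first_return:
  assumes z: "z \<in> S_set" and a: "fst z < 1"
  shows "0 < return_time q (fst z)"
    and "(farey_ext q ^^ return_time q (fst z)) z \<in> R_set q"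
    and "0 < k \<Longrightarrow> k < return_time q (fst z) \<Longrightarrow> (farey_ext q ^^ k) z \<notin> R_set q"
proof -
  let ?N = "return_time q (fst z)" and ?F = "\<lambda>k. (farey_ext q ^^ k) z"
  have S: "?F k \<in> S_set" and f: "fst (?F k) = (farey q ^^ k) (fst z)" for k
    using iterate_farey_ext[OF z] by auto
  have rev: "fst (flip (?F (Suc k))) \<in> I_set q (q - 2 - i)" if "fst (?F k) \<in> I_set q i" "i \<le> q - 2" for k i
    using farey_ext_reversible(1)[OF q3 S that(2,1)] by simp
  have end_cell: "0 < ?N \<and> ?F ?N \<in> R_set q \<and> (0 < k \<longrightarrow> k < ?N \<longrightarrow> ?F k \<notin> R_set q)"
    if i: "i = 0 \<or> i = q - 2" and ai: "fst z \<in> I_set q i"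
      and ex: "\<exists>n. (farey q ^^ n) (fst z) \<notin> I_set q i" for i k
  proof -
    have N: "?N = exit_time q i (fst z)"
      using i ai first_last_distinct by (auto simp: return_time_def)
    note e = exit_time_props[OF ai ex, folded N f]
    define j where "j = (if i = 0 then q - 2 else 0)"
    have j: "q - 2 - i = j" using i by (auto simp: j_def)
    have H: "fst (flip (?F k)) \<in> I_set q j" if "0 < k" "k \<le> ?N" for k
      using rev[of "k - 1" i] e(3)[of "k - 1"] that i unfolding j by auto
    have "?F ?N \<in> R_set q"
      using e(1,2) H[of ?N] i S first_last_distinct[of "fst (flip (?F ?N))"]
      unfolding R_set_iff[OF q3] j_def by (auto split: if_splits)
    moreover have "?F k \<notin> R_set q" if "0 < k" "k < ?N"
      using e(3)[of k] H[of k] that i unfolding R_set_iff[OF q3] j_def by (auto split: if_splits)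
    ultimately show ?thesis using e(1) by blast
  qed
  have "0 < ?N \<and> ?F ?N \<in> R_set q \<and> (0 < k \<longrightarrow> k < ?N \<longrightarrow> ?F k \<notin> R_set q)" for k
  proof (cases "fst z \<in> I_set q 0 \<or> fst z \<in> I_set q (q - 2)")
    case True
    then show ?thesis
      using end_cell[of 0] end_cell[of "q - 2"] exit_first a exit_last by blast
  next
    case False
    then have N: "?N = 1" by (simp add: return_time_def)
    obtain i where i: "i \<le> q - 2" "fst z \<in> I_set q i" using I_set_cover[OF q3 S_set_fst[OF q3 z]] .
    with False have "i \<noteq> 0" "i \<noteq> q - 2" by (metis, metis)
    moreover define j where "j = q - 2 - i"
    ultimately have "j \<noteq> 0" "j \<noteq> q - 2" "j \<le> q - 2" using i by auto
    moreover have "fst (flip (?F 1)) \<in> I_set q j" using rev[of 0 i] i by (simp add: j_def)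
    ultimately have "fst (flip (?F 1)) \<notin> I_set q 0" "fst (flip (?F 1)) \<notin> I_set q (q - 2)"
      using I_set_disjoint[OF q3] by blast+
    then show ?thesis using S[of 1] unfolding N R_set_iff[OF q3] by auto
  qed
  then show "0 < ?N" "?F ?N \<in> R_set q" "0 < k \<Longrightarrow> k < ?N \<Longrightarrow> ?F k \<notin> R_set q"
    by blast+
qed

section \<open>The accelerated map on \<open>core_set\<close>\<close>

lemma R_set_subset: "R_set q \<subseteq> S_set"
  by (auto simp: R_set_def)

lemma gauss_ext_in_S: "z \<in> S_set \<Longrightarrow> gauss_ext q z \<in> S_set"
  by (simp add: gauss_ext_eq iterate_farey_ext)

lemma fst_gauss_ext: "z \<in> S_set \<Longrightarrow> fst (gauss_ext q z) = gauss q (fst z)"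
  by (simp add: gauss_ext_eq gauss_eq iterate_farey_ext)

lemma gauss_ext_in_R: "z \<in> R_set q \<Longrightarrow> gauss_ext q z \<in> R_set q"
proof (cases "fst z = 1")
  case False
  assume z: "z \<in> R_set q"
  then have S: "z \<in> S_set" using R_set_subset by auto
  then have "fst z < 1" using S_set_fst[OF q3 S] False by auto
  then show ?thesis using first_return(2)[OF S] by (simp add: gauss_ext_eq)
qed (simp add: gauss_ext_eq return_time_1)

lemma gauss_range: "a \<in> {0<..1} \<Longrightarrow> gauss q a \<in> {0<..1}"
  unfolding gauss_eq by (rule iterate_farey_range)

lemma regular_flip: "z \<in> regular_set q \<Longrightarrow> flip z \<in> regular_set q"
  by (auto simp: regular_set_def flip_in_S flip_flip)

lemma regular_less_1: "z \<in> regular_set q \<Longrightarrow> fst z < 1"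
  unfolding regular_set_def by (auto dest: spec[of _ 0])

text \<open>The backward orbit gains one point, the flip of the image. Its first coordinate cannot
  be 1, because 1 is fixed by \<open>farey\<close> and the next point is \<open>flip z\<close>,
  whose first coordinate is below 1.\<close>

lemma regular_farey_ext:
  assumes "z \<in> regular_set q"
  shows "farey_ext q z \<in> regular_set q"
proof -
  have z: "z \<in> S_set" and lt: "fst ((farey_ext q ^^ n) z) < 1" "fst ((farey_ext q ^^ n) (flip z)) < 1" for n
    using assms by (auto simp: regular_set_def)
  let ?w = "flip (farey_ext q z)"
  have wS: "?w \<in> S_set" using farey_ext_in_S[OF q3 z] by (rule flip_in_S)
  have w: "farey_ext q ?w = flip z" using farey_ext_flip_farey_ext[OF q3 z] .
  have "fst ?w \<noteq> 1"
  proof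
    assume "fst ?w = 1"
    then have "fst (flip z) = 1" using fst_farey_ext[OF q3 wS] w farey_1(2) by simp
    then show False using lt(2)[of 0] by simp
  qed
  then have "fst ?w < 1" using S_set_fst[OF q3 wS] by auto
  moreover have "fst ((farey_ext q ^^ Suc n) ?w) < 1" for n
    using lt(2)[of n] by (simp only: funpow_Suc_right o_apply w)
  ultimately have "fst ((farey_ext q ^^ n) ?w) < 1" for n
    by (cases n) auto
  moreover have "fst ((farey_ext q ^^ n) (farey_ext q z)) < 1" for n
    using lt(1)[of "Suc n"] by (simp only: funpow_Suc_right o_apply)
  ultimately show ?thesis
    using farey_ext_in_S[OF q3 z] by (auto simp: regular_set_def)
qed

lemma regular_iterate: "z \<in> regular_set q \<Longrightarrow> (farey_ext q ^^ n) z \<in> regular_set q"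
  by (induction n) (auto intro: regular_farey_ext)

lemma gauss_ext_in_core_set: "z \<in> core_set q \<Longrightarrow> gauss_ext q z \<in> core_set q"
  using gauss_ext_in_R by (auto simp: gauss_ext_eq regular_iterate)

lemma flip_in_core_set: "z \<in> core_set q \<Longrightarrow> flip z \<in> core_set q"
  using flip_in_R[OF q3] regular_flip by auto

lemma iterate_reversible:
  "z \<in> S_set \<Longrightarrow> (farey_ext q ^^ k) (flip ((farey_ext q ^^ (k + m)) z)) = flip ((farey_ext q ^^ m) z)"
proof (induction k arbitrary: m)
  case (Suc k)
  have "(farey_ext q ^^ Suc k) (flip ((farey_ext q ^^ (Suc k + m)) z)) =
      farey_ext q ((farey_ext q ^^ k) (flip ((farey_ext q ^^ (k + Suc m)) z)))"
    by simp
  also have "\<dots> = farey_ext q (flip (farey_ext q ((farey_ext q ^^ m) z)))"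
    using Suc.IH[of "Suc m"] Suc.prems by simp
  also have "\<dots> = flip ((farey_ext q ^^ m) z)"
    using Suc.prems by (intro farey_ext_flip_farey_ext[OF q3] iterate_farey_ext)
  finally show ?case .
qed simp

text \<open>From the flipped image \<open>w\<close>, the Farey steps run through the flipped orbit
  of \<open>z\<close> backwards. This orbit segment meets \<open>R_set\<close> only at its two ends,
  so \<open>w\<close> and \<open>z\<close> have the same return time.\<close>

lemma gauss_ext_reversible:
  assumes "z \<in> core_set q"
  shows "gauss_ext q (flip (gauss_ext q z)) = flip z"
proof -
  have zS: "z \<in> S_set" and zR: "z \<in> R_set q" and z1: "fst z < 1"
    using assms R_set_subset regular_less_1 by auto
  define n w where "n = return_time q (fst z)" and "w = flip ((farey_ext q ^^ n) z)"
  have w: "w = flip (gauss_ext q z)" by (simp add: w_def n_def gauss_ext_eq)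
  then have wC: "w \<in> core_set q" using flip_in_core_set[OF gauss_ext_in_core_set[OF assms]] by simp
  then have wS: "w \<in> S_set" and w1: "fst w < 1"
    using R_set_subset regular_less_1 by auto
  define m where "m = return_time q (fst w)"
  note fz = first_return[OF zS z1, folded n_def] and fw = first_return[OF wS w1, folded m_def]
  have bwd: "(farey_ext q ^^ k) w = flip ((farey_ext q ^^ (n - k)) z)" if "k \<le> n" for k
    using iterate_reversible[OF zS, of k "n - k"] that by (simp add: w_def)
  have nw: "(farey_ext q ^^ n) w = flip z" using bwd[of n] by simp
  have "m \<le> n"
  proof (rule ccontr)
    assume "\<not> m \<le> n"
    then have "flip z \<notin> R_set q" using fw(3)[of n] fz(1) nw by simp
    then show False using flip_in_R[OF q3 zR] by simp
  qed
  moreover have "\<not> m < n"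
  proof
    assume "m < n"
    then have "flip ((farey_ext q ^^ (n - m)) z) \<in> R_set q" using fw(2) bwd[of m] by simp
    then have "flip (flip ((farey_ext q ^^ (n - m)) z)) \<in> R_set q" by (rule flip_in_R[OF q3])
    then have "(farey_ext q ^^ (n - m)) z \<in> R_set q" using iterate_farey_ext(1)[OF zS] by (simp add: flip_flip)
    then show False using fz(3)[of "n - m"] \<open>m < n\<close> fw(1) by simp
  qed
  ultimately have "m = n" by simp
  then show ?thesis
    using nw unfolding w[symmetric] by (simp add: gauss_ext_eq[of q w] m_def)
qed

lemma gauss_ext_bij: "bij_betw (gauss_ext q) (core_set q) (core_set q)"
  and gauss_ext_inverse: "z \<in> core_set q \<Longrightarrow> the_inv_into (core_set q) (gauss_ext q) z = flip (gauss_ext q (flip z))"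
proof -
  let ?g = "\<lambda>z. flip (gauss_ext q (flip z))"
  have fl: "flip (flip z) = z" if "z \<in> core_set q" for z using that R_set_subset by (auto simp: flip_flip)
  have g_core: "?g z \<in> core_set q" if "z \<in> core_set q" for z using that by (intro flip_in_core_set gauss_ext_in_core_set)
  have 1: "?g (gauss_ext q z) = z" if "z \<in> core_set q" for z
    using that by (simp add: gauss_ext_reversible fl)
  have 2: "gauss_ext q (?g z) = z" if "z \<in> core_set q" for z
    using gauss_ext_reversible[OF flip_in_core_set[OF that]] that fl by simp
  show "bij_betw (gauss_ext q) (core_set q) (core_set q)"
    by (rule bij_betw_byWitness[where f' = ?g]) (use 1 2 g_core gauss_ext_in_core_set in auto)
  then have "inj_on (gauss_ext q) (core_set q)" by (rule bij_betw_imp_inj_on)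
  then show "z \<in> core_set q \<Longrightarrow> the_inv_into (core_set q) (gauss_ext q) z = ?g z"
    by (rule the_inv_into_f_eq) (use 2 g_core in auto)
qed

text \<open>Return times depend on the first coordinate alone, so one exponent serves the whole
  fibre; it is at least \<open>n\<close> because no point of the orbit lies over
  \<open>a = 1\<close>.\<close>

lemma gauss_ext_iterate_fibre:
  assumes "z \<in> core_set q"
  shows "\<exists>k\<ge>n. \<forall>s. (fst z, s) \<in> S_set \<longrightarrow> (gauss_ext q ^^ n) (fst z, s) = (farey_ext q ^^ k) (fst z, s)"
  using assms
proof (induction n arbitrary: z)
  case (Suc n)
  have zS: "z \<in> S_set" using Suc.prems R_set_subset by auto
  define N where "N = return_time q (fst z)"
  have N: "0 < N" unfolding N_def using Suc.prems regular_less_1 by (intro first_return zS) auto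
  from Suc.IH[OF gauss_ext_in_core_set[OF Suc.prems]] obtain k where k: "n \<le> k"
    "\<And>s. (gauss q (fst z), s) \<in> S_set \<Longrightarrow> (gauss_ext q ^^ n) (gauss q (fst z), s) = (farey_ext q ^^ k) (gauss q (fst z), s)"
    by (auto simp: fst_gauss_ext[OF zS])
  have "(gauss_ext q ^^ Suc n) (fst z, s) = (farey_ext q ^^ (k + N)) (fst z, s)" if s: "(fst z, s) \<in> S_set" for s
  proof -
    have "gauss_ext q (fst z, s) = (gauss q (fst z), snd (gauss_ext q (fst z, s)))"
      using fst_gauss_ext[OF s] by (simp add: prod_eq_iff)
    then have "(gauss_ext q ^^ n) (gauss_ext q (fst z, s)) = (farey_ext q ^^ k) (gauss_ext q (fst z, s))"
      using k(2) gauss_ext_in_S[OF s] by metis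
    also have "gauss_ext q (fst z, s) = (farey_ext q ^^ N) (fst z, s)"
      by (simp add: gauss_ext_eq N_def)
    finally show ?thesis
      by (simp only: funpow_Suc_right funpow_add o_apply gauss_ext_eq[of q "(fst z, s)"] N_def fst_conv)
  qed
  then show ?case using k(1) N by (intro exI[of _ "k + N"]) auto
next
  case 0
  show ?case by (intro exI[of _ 0]) simp
qed

lemma snd_iterate_diff:
  assumes "(a, s) \<in> S_set" "(a, t) \<in> S_set"
  shows "snd ((farey_ext q ^^ k) (a, s)) - snd ((farey_ext q ^^ k) (a, t)) = (rho_prod q k a)\<^sup>2 * (s - t)"
  using assms
proof (induction k arbitrary: a s t)
  case (Suc k)
  let ?i = "cell_index q a"
  have i: "?i \<le> q - 2" "a \<in> I_set q ?i"
    using cell_index[OF q3 S_set_fst[OF q3 Suc.prems(1)]] by auto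
  obtain c where c: "\<And>s. (a, s) \<in> S_set \<Longrightarrow> farey_ext q (a, s) = (farey q a, (rho q ?i a)\<^sup>2 * s + c)"
    using farey_ext_eq(1)[OF q3 i] by blast
  have "snd ((farey_ext q ^^ k) (farey_ext q (a, s))) - snd ((farey_ext q ^^ k) (farey_ext q (a, t)))
      = (rho_prod q k (farey q a))\<^sup>2 * (((rho q ?i a)\<^sup>2 * s + c) - ((rho q ?i a)\<^sup>2 * t + c))"
    unfolding c[OF Suc.prems(1)] c[OF Suc.prems(2)]
    using farey_ext_in_S[OF q3 Suc.prems(1)] farey_ext_in_S[OF q3 Suc.prems(2)]
    by (intro Suc.IH) (simp_all add: c Suc.prems)
  also have "\<dots> = (rho_prod q (Suc k) a)\<^sup>2 * (s - t)"
    by (simp add: power_mult_distrib algebra_simps)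
  finally show ?case by (simp only: funpow_Suc_right o_apply)
qed simp

text \<open>The vector \<open>(a, 1 - a) / rho_prod\<close> is the image of the \<open>k\<close>-th iterate \<open>(a', 1 - a')\<close> under a
  product of \<open>k\<close> of the matrices \<open>M_mat\<close>; each factor adds one coordinate to the other.\<close>

lemma rho_prod_growth:
  assumes "a \<in> {0<..1}" "(farey q ^^ k) a < 1"
  defines "a' \<equiv> (farey q ^^ k) a" and "P \<equiv> rho_prod q k a"
  shows "0 < P \<and> a' \<le> a / P \<and> 1 - a' \<le> (1 - a) / P \<and> real k * (min a' (1 - a'))\<^sup>2 \<le> a / P * ((1 - a) / P)"
  using assms(1,2) unfolding assms(3,4)
proof (induction k arbitrary: a)
  case 0
  then show ?case by simp
next
  case (Suc k)
  let ?i = "cell_index q a" and ?a' = "(farey q ^^ Suc k) a"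
  let ?m = "min ?a' (1 - ?a')"
  define x y z where xyz: "x = sin_quot q (Suc (Suc ?i))" "y = sin_quot q (Suc ?i)" "z = sin_quot q ?i"
  define \<rho> P a1 where d: "\<rho> = rho q ?i a" "P = rho_prod q k (farey q a)" "a1 = farey q a"
  have i: "?i \<le> q - 2" "a \<in> I_set q ?i" using cell_index[OF q3 Suc.prems(1)] by auto
  have det: "y * y - x * z = 1" using sin_quot_det[OF q3, of ?i] by (simp add: xyz)
  have sgn: "0 \<le> x" "1 \<le> y" "0 \<le> z"
    using sin_quot_signs[OF q3 i(1)] by (auto simp: xyz)
  \<comment> \<open>An off-diagonal entry of the matrix is at least 1: \<open>x\<close> in cell 0,
    \<open>z\<close> in all others. It yields the gain of \<open>?m\<^sup>2\<close> in this
    step.\<close>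
  have xz: "1 \<le> x \<or> 1 \<le> z"
    using sin_quot_ge_1[OF q3, of "Suc (Suc ?i)"] sin_quot_ge_1[OF q3, of ?i] i(1) q3
    by (cases "?i = 0") (auto simp: xyz)
  have \<rho>: "0 < \<rho>" using rho_pos[OF q3 i] by (simp add: d)
  have it: "(farey q ^^ k) a1 = ?a'" by (simp only: funpow_Suc_right o_apply d)
  have IH: "0 < P" "?a' \<le> a1 / P" "1 - ?a' \<le> (1 - a1) / P" "real k * ?m\<^sup>2 \<le> a1 / P * ((1 - a1) / P)"
    using Suc.IH[of a1] farey_range[OF Suc.prems(1)] Suc.prems(2) unfolding it d by (auto simp only: d(3)[symmetric] it)
  have 1: "a1 = (y * a - x * (1 - a)) / \<rho>"
    using farey_eq[OF q3 i] by (simp add: d xyz)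
  have 2: "1 - a1 = (y * (1 - a) - z * a) / \<rho>"
    using \<rho> rho_eq[OF q3, of ?i a] unfolding 1 by (simp add: d(1)[symmetric] xyz[symmetric] field_simps)
  define \<alpha> \<beta> where ab: "\<alpha> = a1 / P" "\<beta> = (1 - a1) / P"
  have "\<rho> * (y * a1 + x * (1 - a1)) = (y * y - x * z) * a" "\<rho> * (z * a1 + y * (1 - a1)) = (y * y - x * z) * (1 - a)"
  proof -
    have r: "\<rho> * a1 = y * a - x * (1 - a)" "\<rho> * (1 - a1) = y * (1 - a) - z * a"
      using \<rho> unfolding 2 unfolding 1 by simp_all
    have "\<rho> * (y * a1 + x * (1 - a1)) = y * (\<rho> * a1) + x * (\<rho> * (1 - a1))"
      "\<rho> * (z * a1 + y * (1 - a1)) = z * (\<rho> * a1) + y * (\<rho> * (1 - a1))"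
      by (simp_all add: algebra_simps)
    then show "\<rho> * (y * a1 + x * (1 - a1)) = (y * y - x * z) * a" "\<rho> * (z * a1 + y * (1 - a1)) = (y * y - x * z) * (1 - a)"
      unfolding r by (simp_all add: algebra_simps)
  qed
  then have "a = \<rho> * (y * a1 + x * (1 - a1))" "1 - a = \<rho> * (z * a1 + y * (1 - a1))"
    by (simp_all add: det)
  then have "a / (\<rho> * P) = (y * a1 + x * (1 - a1)) / P" "(1 - a) / (\<rho> * P) = (z * a1 + y * (1 - a1)) / P"
    using \<rho> by simp_all
  then have A: "a / (\<rho> * P) = y * \<alpha> + x * \<beta>" and B: "(1 - a) / (\<rho> * P) = z * \<alpha> + y * \<beta>"
    by (simp_all add: ab add_divide_distrib)
  have a'0: "0 < ?a'" "?a' < 1" using iterate_farey_range[OF Suc.prems(1), of "Suc k"] Suc.prems(2) by auto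
  then have m: "0 \<le> ?m" "?m \<le> \<alpha>" "?m \<le> \<beta>" "0 \<le> \<alpha>" "0 \<le> \<beta>" "?a' \<le> \<alpha>" "1 - ?a' \<le> \<beta>"
    using IH(2,3) by (auto simp: ab)
  have y: "\<alpha> \<le> y * \<alpha>" "\<beta> \<le> y * \<beta>" and x: "0 \<le> x * \<beta>" and z: "0 \<le> z * \<alpha>"
    using sgn m mult_right_mono[of 1 y] by auto
  have mm: "?m\<^sup>2 \<le> \<alpha>\<^sup>2" "?m\<^sup>2 \<le> \<beta>\<^sup>2" using m by (auto intro!: power_mono)
  have "\<alpha> * \<beta> + ?m\<^sup>2 \<le> (y * \<alpha> + x * \<beta>) * (z * \<alpha> + y * \<beta>)"
    using xz
  proof
    assume "1 \<le> x"
    then have "\<beta> \<le> x * \<beta>" using m mult_right_mono[of 1 x \<beta>] by auto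
    then have "(\<alpha> + \<beta>) * \<beta> \<le> (y * \<alpha> + x * \<beta>) * (z * \<alpha> + y * \<beta>)"
      using x y z m by (intro mult_mono) auto
    then show ?thesis using mm by (simp add: algebra_simps power2_eq_square)
  next
    assume "1 \<le> z"
    then have "\<alpha> \<le> z * \<alpha>" using m mult_right_mono[of 1 z \<alpha>] by auto
    then have "\<alpha> * (\<alpha> + \<beta>) \<le> (y * \<alpha> + x * \<beta>) * (z * \<alpha> + y * \<beta>)"
      using x y z m by (intro mult_mono) auto
    then show ?thesis using mm by (simp add: algebra_simps power2_eq_square)
  qed
  moreover have "real (Suc k) * ?m\<^sup>2 = real k * ?m\<^sup>2 + ?m\<^sup>2" by (simp add: algebra_simps)
  ultimately have "real (Suc k) * ?m\<^sup>2 \<le> (y * \<alpha> + x * \<beta>) * (z * \<alpha> + y * \<beta>)"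
    using IH(4) unfolding ab[symmetric] by linarith
  moreover have "?a' \<le> y * \<alpha> + x * \<beta>" "1 - ?a' \<le> z * \<alpha> + y * \<beta>"
    using m y x z by linarith+
  moreover have "rho_prod q (Suc k) a = \<rho> * P" by (simp add: d)
  ultimately show ?case
    using \<rho> IH(1) A B by (metis mult_pos_pos)
qed

text \<open>The fibre over \<open>a\<close> has length at most \<open>1 / (a * (1 - a))\<close>.
  Multiplied by the slope \<open>P\<^sup>2\<close> this is the reciprocal of
  \<open>a / P * ((1 - a) / P)\<close>, which grows at least linearly in \<open>k\<close>.\<close>

lemma fibre_contraction:
  assumes st: "(a, s) \<in> S_set" "(a, t) \<in> S_set" and lt: "(farey q ^^ k) a < 1" and "0 < k"
  defines "a' \<equiv> (farey q ^^ k) a"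
  shows "\<bar>snd ((farey_ext q ^^ k) (a, s)) - snd ((farey_ext q ^^ k) (a, t))\<bar> \<le> 1 / (real k * (min a' (1 - a'))\<^sup>2)"
proof -
  have a: "a \<in> {0<..1}" using S_set_fst[OF q3 st(1)] by simp
  define P m where "P = rho_prod q k a" and "m = min a' (1 - a')"
  have g: "0 < P" "1 - a' \<le> (1 - a) / P" "real k * m\<^sup>2 \<le> a / P * ((1 - a) / P)"
    using rho_prod_growth[OF a lt] by (auto simp: P_def m_def a'_def)
  have "0 < a'" using iterate_farey_range[OF a, of k] by (simp add: a'_def)
  then have m: "0 < m" using lt by (simp add: m_def a'_def)
  have "0 < (1 - a) / P" using g(2) lt by (simp add: a'_def)
  then have b: "0 < 1 - a" using g(1) by (simp add: zero_less_divide_iff)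
  have ab: "0 < a * (1 - a)" using a b by simp
  have "s < 1 / (a * (1 - a))" "t < 1 / (a * (1 - a))" "0 \<le> s" "0 \<le> t"
    using st ab by (auto simp: S_set_iff less_divide_eq mult.assoc)
  then have "\<bar>s - t\<bar> \<le> 1 / (a * (1 - a))" by linarith
  then have "P\<^sup>2 * \<bar>s - t\<bar> \<le> P\<^sup>2 * (1 / (a * (1 - a)))" by (intro mult_left_mono) auto
  also have "\<dots> = 1 / (a / P * ((1 - a) / P))" using g(1) by (simp add: power2_eq_square)
  also have "\<dots> \<le> 1 / (real k * m\<^sup>2)" using g(3) m \<open>0 < k\<close> by (intro frac_le) auto
  finally show ?thesis
    by (simp add: snd_iterate_diff[OF st] abs_mult P_def m_def)
qed

end


section \<open>Invariance of the Lebesgue measure\<close>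

lemma skew_product_vimage_borel:
  fixes f g c :: "real \<Rightarrow> real" and E :: "(real \<times> real) set"
  assumes [measurable]: "f \<in> borel_measurable borel" "g \<in> borel_measurable borel" "c \<in> borel_measurable borel"
    and E: "E \<in> sets borel"
  shows "{z. fst z \<in> {l<..r} \<and> (f (fst z), snd z / g (fst z) + c (fst z)) \<in> E} \<in> sets borel"
proof -
  have [measurable]: "E \<in> sets (borel \<Otimes>\<^sub>M borel)"
    using E unfolding borel_prod .
  have "{z \<in> space (borel \<Otimes>\<^sub>M borel). fst z \<in> {l<..r} \<and> (f (fst z), snd z / g (fst z) + c (fst z)) \<in> E}
      \<in> sets (borel \<Otimes>\<^sub>M borel)"
    by measurable
  then show ?thesis unfolding borel_prod by simp
qed

text \<open>The map multiplies lengths in the base by \<open>f'\<close> and in the fibres by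
  \<open>1 / f'\<close>. Tonelli turns the area into an integral of fibre lengths, and substitution
  in the base absorbs the factor \<open>f'\<close>.\<close>

lemma emeasure_skew_product:
  fixes f f' c :: "real \<Rightarrow> real" and E :: "(real \<times> real) set"
  assumes [measurable]: "f \<in> borel_measurable borel" "f' \<in> borel_measurable borel" "c \<in> borel_measurable borel"
    and E [measurable]: "E \<in> sets borel" and E_sub: "fst ` E \<subseteq> {f l..f r}"
    and lr: "l < r"
    and deriv: "\<And>x. x \<in> {l..r} \<Longrightarrow> (f has_real_derivative f' x) (at x)"
    and cont: "continuous_on {l..r} f'"
    and pos: "\<And>x. x \<in> {l..r} \<Longrightarrow> 0 < f' x"
  shows "emeasure lborel {z. fst z \<in> {l<..r} \<and> (f (fst z), snd z / f' (fst z) + c (fst z)) \<in> E} = emeasure lborel E"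
proof -
  define D where "D = {z. fst z \<in> {l<..r} \<and> (f (fst z), snd z / f' (fst z) + c (fst z)) \<in> E}"
  have E2 [measurable]: "E \<in> sets (borel \<Otimes>\<^sub>M borel)" and D2 [measurable]: "D \<in> sets (borel \<Otimes>\<^sub>M borel)"
    unfolding borel_prod D_def by (rule E, (rule skew_product_vimage_borel assms)+)
  define \<psi> where "\<psi> = (\<lambda>a. \<integral>\<^sup>+s. indicator E (a, s) \<partial>lborel)"
  have \<psi> [measurable]: "\<psi> \<in> borel_measurable borel"
    unfolding \<psi>_def by measurable
  have D: "D \<in> sets (lborel \<Otimes>\<^sub>M lborel)" and E': "E \<in> sets (lborel \<Otimes>\<^sub>M lborel)"
    using D2 E2 unfolding borel_prod lborel_prod by simp_all
  have fub: "emeasure lborel A = (\<integral>\<^sup>+a. \<integral>\<^sup>+s. indicator A (a, s) \<partial>lborel \<partial>lborel)"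
    if "A \<in> sets (lborel \<Otimes>\<^sub>M lborel)" for A :: "(real \<times> real) set"
    using lborel.emeasure_pair_measure[OF that] by (simp add: lborel_prod)
  have fibre: "(\<integral>\<^sup>+s. indicator D (a, s) \<partial>lborel) = \<psi> (f a) * f' a * indicator {l<..r} a" for a
  proof (cases "a \<in> {l<..r}")
    case True
    then have f': "0 < f' a" using pos by auto
    have "\<psi> (f a) = ennreal \<bar>1 / f' a\<bar> * (\<integral>\<^sup>+s. indicator E (f a, c a + 1 / f' a * s) \<partial>lborel)"
      unfolding \<psi>_def using f' by (intro nn_integral_real_affine) auto
    also have "(\<lambda>s. indicator E (f a, c a + 1 / f' a * s) :: ennreal) = (\<lambda>s. indicator D (a, s))"
      using True by (auto simp: D_def indicator_def fun_eq_iff add.commute)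
    finally have "\<psi> (f a) * ennreal (f' a) = (\<integral>\<^sup>+s. indicator D (a, s) \<partial>lborel) * (ennreal (1 / f' a) * ennreal (f' a))"
      using f' by (simp add: mult_ac)
    also have "ennreal (1 / f' a) * ennreal (f' a) = 1"
      using f' by (simp flip: ennreal_mult)
    finally show ?thesis using True by simp
  next
    case False
    then have "(a, s) \<notin> D" for s by (auto simp: D_def)
    with False show ?thesis by simp
  qed
  have "emeasure lborel D = (\<integral>\<^sup>+a. \<psi> (f a) * f' a * indicator {l<..r} a \<partial>lborel)"
    by (simp add: fub[OF D] fibre)
  \<comment> \<open>The substitution rule is stated for closed intervals; the added endpoint is a
    null set.\<close>
  also have "\<dots> = (\<integral>\<^sup>+a. \<psi> (f a) * f' a * indicator {l..r} a \<partial>lborel)"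
    using AE_lborel_singleton[of l] by (intro nn_integral_cong_AE) (auto elim!: eventually_mono simp: indicator_def)
  also have "\<dots> = (\<integral>\<^sup>+a. \<psi> a * indicator {f l..f r} a \<partial>lborel)"
    using pos by (intro nn_integral_substitution_aux[symmetric] deriv cont lr) (auto intro: less_imp_le)
  also have "\<dots> = (\<integral>\<^sup>+a. \<psi> a \<partial>lborel)"
  proof (intro nn_integral_cong)
    fix a
    have "\<psi> a = 0" if "a \<notin> {f l..f r}"
    proof -
      have "(a, s) \<notin> E" for s using E_sub that by force
      then show ?thesis by (simp add: \<psi>_def)
    qed
    then show "\<psi> a * indicator {f l..f r} a = \<psi> a" by (auto simp: indicator_def)
  qed
  also have "\<dots> = emeasure lborel E" by (simp add: fub[OF E'] \<psi>_def)
  finally show ?thesis by (simp add: D_def)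
qed

section \<open>Generalities on measure-preserving maps\<close>

lemma measure_preserving_funpow:
  "measure_preserving M T \<Longrightarrow> measure_preserving M (T ^^ n)"
proof (induction n)
  case 0
  show ?case by (simp add: measure_preserving_def id_def)
next
  case (Suc n)
  then have [measurable]: "T \<in> M \<rightarrow>\<^sub>M M" "T ^^ n \<in> M \<rightarrow>\<^sub>M M" by (auto simp: measure_preserving_def)
  have "distr M M (T \<circ> T ^^ n) = distr (distr M M (T ^^ n)) M T"
    by (intro distr_distr[symmetric]) auto
  then show ?case using Suc by (simp add: measure_preserving_def o_def)
qed

lemma measure_preserving_AE:
  assumes "measure_preserving M T" "AE x in M. P x"
  shows "AE x in M. P (T x)"
proof -
  from assms(2) obtain N where N: "{x \<in> space M. \<not> P x} \<subseteq> N" "N \<in> null_sets M"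
    by (auto simp: eventually_ae_filter)
  have T: "T \<in> M \<rightarrow>\<^sub>M M" "distr M M T = M" using assms(1) by (auto simp: measure_preserving_def)
  have "emeasure M (T -` N \<inter> space M) = emeasure (distr M M T) N"
    using N by (simp add: emeasure_distr[OF T(1)] null_setsD2)
  then have "T -` N \<inter> space M \<in> null_sets M"
    using T N by (auto intro!: null_setsI measurable_sets[OF T(1)] simp: T(2))
  moreover have "{x \<in> space M. \<not> P (T x)} \<subseteq> T -` N \<inter> space M"
    using N(1) measurable_space[OF T(1)] by auto
  ultimately show ?thesis by (auto simp: eventually_ae_filter intro!: bexI[of _ "T -` N \<inter> space M"])
qed

section \<open>Lebesgue measure and measurability on \<open>S_set\<close>\<close>

definition S_measure :: "(real \<times> real) measure" where
  "S_measure = restrict_space lborel S_set"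

lemma S_set_borel [measurable]: "S_set \<in> sets borel"
proof -
  have "S_set = {z \<in> space (borel \<Otimes>\<^sub>M borel). 0 < fst z \<and> fst z \<le> 1 \<and> 0 \<le> snd z \<and> snd z * fst z * (1 - fst z) < 1}"
    by (auto simp: S_set_iff space_pair_measure)
  also have "\<dots> \<in> sets (borel \<Otimes>\<^sub>M borel)" by measurable
  finally show ?thesis unfolding borel_prod .
qed

lemma space_S_measure [simp]: "space S_measure = S_set"
  by (simp add: S_measure_def space_restrict_space)

lemma sets_S_measure: "A \<in> sets S_measure \<longleftrightarrow> A \<in> sets borel \<and> A \<subseteq> S_set"
  by (auto simp: S_measure_def sets_restrict_space_iff)

lemma emeasure_S_measure: "A \<subseteq> S_set \<Longrightarrow> emeasure S_measure A = emeasure lborel A"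
  by (simp add: S_measure_def emeasure_restrict_space)

lemma measurable_S_measureI:
  "f \<in> borel_measurable borel \<Longrightarrow> (\<And>z. z \<in> S_set \<Longrightarrow> f z \<in> S_set) \<Longrightarrow> f \<in> S_measure \<rightarrow>\<^sub>M S_measure"
  unfolding S_measure_def by (intro measurable_restrict_space3) auto

lemma fst_S_measure [measurable]: "fst \<in> S_measure \<rightarrow>\<^sub>M restrict_space borel {0<..1}"
  unfolding S_measure_def
  by (intro measurable_restrict_space3) (auto simp: S_set_iff simp flip: borel_prod)

lemma flip_measurable [measurable]: "flip \<in> S_measure \<rightarrow>\<^sub>M S_measure"
proof (rule measurable_S_measureI)
  have "flip = (\<lambda>z. pt (1 / fst z - snd z * (1 - fst z)) (snd z * fst z) (1 - fst z) (fst z))"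
    by (simp add: flip_def fun_eq_iff)
  moreover have "\<dots> \<in> borel \<Otimes>\<^sub>M borel \<rightarrow>\<^sub>M borel \<Otimes>\<^sub>M borel"
    unfolding pt_def by measurable
  ultimately show "flip \<in> borel_measurable borel"
    unfolding borel_prod by simp
qed (rule flip_in_S)

context
  fixes q :: nat
  assumes q3: "q \<ge> 3"
begin

lemma I_set_borel [measurable]: "I_set q i \<in> sets borel"
  by (simp add: I_set_def)

lemma cell_index_measurable [measurable]: "cell_index q \<in> restrict_space borel {0<..1} \<rightarrow>\<^sub>M count_space UNIV"
proof -
  have "cell_index q -` {i} \<inter> space (restrict_space borel {0<..1}) \<in> sets (restrict_space borel {0<..1})" for i
  proof -
    have "cell_index q -` {i} \<inter> {0<..1} = (if i \<le> q - 2 then I_set q i else {})"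
    proof (intro set_eqI iffI)
      fix a assume "a \<in> cell_index q -` {i} \<inter> {0<..1}"
      then have "i \<le> q - 2" "a \<in> I_set q i" using cell_index[OF q3, of a] by (blast, blast)
      then show "a \<in> (if i \<le> q - 2 then I_set q i else {})" by simp
    next
      fix a assume "a \<in> (if i \<le> q - 2 then I_set q i else {})"
      then have "i \<le> q - 2" "a \<in> I_set q i" by (auto split: if_splits)
      then show "a \<in> cell_index q -` {i} \<inter> {0<..1}"
        using cell_index_eq[OF q3] I_set_subset[OF q3] by blast
    qed
    then show ?thesis
      using I_set_subset[OF q3, of i] by (auto simp: space_restrict_space sets_restrict_space_iff)
  qed
  then show ?thesis
    by (simp add: measurable_count_space_eq2_countable)
qed

text \<open>The formula of \<open>farey\<close> on the cell \<open>i\<close>, extended to the whole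
  line: differentiation and substitution take place on the closed cell, at whose endpoints
  \<open>farey\<close> itself may jump.\<close>

definition branch :: "nat \<Rightarrow> real \<Rightarrow> real" where
  "branch i a = (sin_quot q (Suc i) * a - sin_quot q (Suc (Suc i)) * (1 - a)) / rho q i a"

definition shift :: "nat \<Rightarrow> real \<Rightarrow> real" where
  "shift i a = (rho q i a)\<^sup>2 * sin_quot q (Suc (Suc i)) / (a * (sin_quot q (Suc i) * a - sin_quot q (Suc (Suc i)) * (1 - a)))"

lemma rho_measurable [measurable]: "rho q i \<in> borel_measurable borel"
  unfolding rho_eq[OF q3, abs_def] by measurable

lemma branch_measurable [measurable]: "branch i \<in> borel_measurable borel"
  and shift_measurable [measurable]: "shift i \<in> borel_measurable borel"
  unfolding branch_def[abs_def] shift_def[abs_def] by measurable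

lemma farey_branch: "i \<le> q - 2 \<Longrightarrow> a \<in> I_set q i \<Longrightarrow> farey q a = branch i a"
  by (simp add: branch_def farey_eq[OF q3])

lemma farey_ext_branch:
  "i \<le> q - 2 \<Longrightarrow> fst z \<in> I_set q i \<Longrightarrow> z \<in> S_set \<Longrightarrow>
    farey_ext q z = (branch i (fst z), (rho q i (fst z))\<^sup>2 * snd z + shift i (fst z))"
  by (cases z) (simp add: farey_ext_eq(1)[OF q3] farey_branch shift_def)

lemma farey_measurable [measurable]: "farey q \<in> restrict_space borel {0<..1} \<rightarrow>\<^sub>M restrict_space borel {0<..1}"
proof (rule measurable_restrict_space2)
  show "farey q \<in> space (restrict_space borel {0<..1}) \<rightarrow> {0<..1}"
    using farey_range[OF q3] by (auto simp: space_restrict_space)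
  have "(\<lambda>a. branch (cell_index q a) a) \<in> borel_measurable (restrict_space borel {0<..1})"
    by (rule measurable_compose_countable[OF _ cell_index_measurable]) (auto intro: measurable_restrict_space1)
  then show "farey q \<in> borel_measurable (restrict_space borel {0<..1})"
    by (rule measurable_cong[THEN iffD1, rotated])
       (simp add: farey_branch[OF cell_index[OF q3]] space_restrict_space)
qed

lemma farey_ext_measurable [measurable]: "farey_ext q \<in> S_measure \<rightarrow>\<^sub>M S_measure"
proof -
  have "(\<lambda>z. (branch i (fst z), (rho q i (fst z))\<^sup>2 * snd z + shift i (fst z))) \<in> borel_measurable S_measure" for i
  proof -
    have "(\<lambda>z. (branch i (fst z), (rho q i (fst z))\<^sup>2 * snd z + shift i (fst z))) \<in> borel \<Otimes>\<^sub>M borel \<rightarrow>\<^sub>M borel \<Otimes>\<^sub>M borel"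
      by measurable
    then show ?thesis
      unfolding S_measure_def by (intro measurable_restrict_space1) (simp only: borel_prod measurable_lborel2)
  qed
  then have "(\<lambda>z. (branch (cell_index q (fst z)) (fst z), (rho q (cell_index q (fst z)) (fst z))\<^sup>2 * snd z + shift (cell_index q (fst z)) (fst z)))
      \<in> borel_measurable S_measure"
    by (rule measurable_compose_countable[where g = "\<lambda>z. cell_index q (fst z)"]) measurable
  then have "farey_ext q \<in> borel_measurable S_measure"
    by (rule measurable_cong[THEN iffD1, rotated])
       (simp add: farey_ext_branch[OF cell_index[OF q3 S_set_fst[OF q3]]])
  then show ?thesis
    unfolding S_measure_def using farey_ext_in_S[OF q3]
    by (intro measurable_restrict_space2) (auto simp: space_restrict_space)
qed

text \<open>At an endpoint of the cell one coordinate of the image vector vanishes, but a positive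
  combination of both equals the determinant 1, so their sum stays positive.\<close>

lemma rho_pos_closed:
  assumes i: "i \<le> q - 2" and a: "a \<in> {cut q (Suc i)..cut q i}"
  shows "0 < rho q i a"
proof -
  define x y z where xyz: "x = sin_quot q (Suc (Suc i))" "y = sin_quot q (Suc i)" "z = sin_quot q i"
  have det: "y * y - x * z = 1" using sin_quot_det[OF q3, of i] by (simp add: xyz)
  have sgn: "0 \<le> x" "1 \<le> y" "0 \<le> z" using sin_quot_signs[OF q3 i] by (auto simp: xyz)
  define u v where uv: "u = y * a - x * (1 - a)" "v = y * (1 - a) - z * a"
  have "x / (x + y) \<le> a" "a \<le> y / (y + z)" using a by (auto simp: cut_def[OF q3] xyz)
  then have uv0: "0 \<le> u" "0 \<le> v" using sgn by (auto simp: uv field_simps)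
  have "(y + z) * u + (x + y) * v = y * y - x * z" by (simp add: uv algebra_simps)
  then have "(y + z) * u + (x + y) * v = 1" by (simp add: det)
  then have "u \<noteq> 0 \<or> v \<noteq> 0" by auto
  then show ?thesis using uv0 by (auto simp: rho_eq[OF q3] xyz[symmetric] uv[symmetric])
qed

text \<open>The quotient rule leaves the determinant 1 in the numerator, as for every unimodular
  fractional linear map.\<close>

lemma branch_deriv:
  assumes i: "i \<le> q - 2" and a: "a \<in> {cut q (Suc i)..cut q i}"
  shows "(branch i has_real_derivative 1 / (rho q i a)\<^sup>2) (at a)"
proof -
  define x y z where xyz: "x = sin_quot q (Suc (Suc i))" "y = sin_quot q (Suc i)" "z = sin_quot q i"
  have det: "y * y - x * z = 1" using sin_quot_det[OF q3, of i] by (simp add: xyz)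
  have r: "rho q i t = (x - z) * t + (y - x)" for t by (simp add: rho_eq[OF q3] xyz algebra_simps)
  have b: "branch i = (\<lambda>t. ((x + y) * t - x) / ((x - z) * t + (y - x)))"
    by (simp add: branch_def r xyz[symmetric] fun_eq_iff algebra_simps)
  have nz: "(x - z) * a + (y - x) \<noteq> 0" using rho_pos_closed[OF i a] by (simp add: r)
  have "(branch i has_real_derivative
      ((x + y) * ((x - z) * a + (y - x)) - ((x + y) * a - x) * (x - z)) / ((x - z) * a + (y - x))\<^sup>2) (at a)"
    unfolding b using nz by (auto intro!: derivative_eq_intros simp: power2_eq_square)
  also have "(x + y) * ((x - z) * a + (y - x)) - ((x + y) * a - x) * (x - z) = y * y - x * z"
    by (simp add: algebra_simps)
  finally show ?thesis by (simp add: det r)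
qed

text \<open>Every branch is full, so its range contains the first coordinates of any part of
  \<open>S_set\<close>, as the area formula for skew products demands.\<close>

lemma branch_ends: "i \<le> q - 2 \<Longrightarrow> branch i (cut q (Suc i)) = 0" "i \<le> q - 2 \<Longrightarrow> branch i (cut q i) = 1"
proof -
  assume i: "i \<le> q - 2"
  define x y z where xyz: "x = sin_quot q (Suc (Suc i))" "y = sin_quot q (Suc i)" "z = sin_quot q i"
  have sgn: "0 \<le> x" "1 \<le> y" "0 \<le> z" using sin_quot_signs[OF q3 i] by (auto simp: xyz)
  have c: "cut q (Suc i) = x / (x + y)" "cut q i = y / (y + z)" by (simp_all add: cut_def[OF q3] xyz)
  have "y * (x / (x + y)) - x * (1 - x / (x + y)) = 0" using sgn by (simp add: field_simps)
  then show "branch i (cut q (Suc i)) = 0" by (simp add: branch_def xyz[symmetric] c)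
  have "y * (1 - y / (y + z)) - z * (y / (y + z)) = 0" using sgn by (simp add: field_simps)
  moreover have "0 < rho q i (cut q i)" using rho_pos_closed[OF i] cut_less[OF q3 i] by simp
  ultimately show "branch i (cut q i) = 1"
    by (simp add: branch_def rho_eq[OF q3] xyz[symmetric] c)
qed

lemma branch_inj:
  assumes "i \<le> q - 2" "a \<in> I_set q i" "a' \<in> I_set q i" "branch i a = branch i a'"
  shows "a = a'"
proof -
  define x y z where xyz: "x = sin_quot q (Suc (Suc i))" "y = sin_quot q (Suc i)" "z = sin_quot q i"
  have det: "y * y - x * z = 1" using sin_quot_det[OF q3, of i] by (simp add: xyz)
  have r: "rho q i t = (x - z) * t + (y - x)" for t by (simp add: rho_eq[OF q3] xyz algebra_simps)
  have b: "branch i = (\<lambda>t. ((x + y) * t - x) / rho q i t)"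
    by (simp add: branch_def xyz[symmetric] fun_eq_iff algebra_simps)
  have "0 < rho q i a" "0 < rho q i a'" using assms rho_pos[OF q3] by auto
  then have "((x + y) * a - x) * rho q i a' = ((x + y) * a' - x) * rho q i a"
    using assms(4) by (simp add: b frac_eq_eq)
  then have "(y * y - x * z) * (a - a') = 0" by (simp add: r algebra_simps)
  then show ?thesis by (simp add: det)
qed

abbreviation (input) farey_inv :: "real \<times> real \<Rightarrow> real \<times> real" where
  "farey_inv \<equiv> \<lambda>z. flip (farey_ext q (flip z))"

lemma farey_inv_right: "z \<in> S_set \<Longrightarrow> farey_ext q (farey_inv z) = z"
  using farey_ext_flip_farey_ext[OF q3 flip_in_S] by (simp add: flip_flip)

lemma farey_inv_left: "z \<in> S_set \<Longrightarrow> farey_inv (farey_ext q z) = z"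
  using farey_ext_flip_farey_ext[OF q3] by (simp add: flip_flip)

text \<open>The preimage of \<open>B\<close> is cut along the cells into the sets
  \<open>V i\<close>. The image of a cell consists of the points whose flip lies in the dual cell,
  so \<open>V i\<close> is carried to \<open>B \<inter> J i\<close>, of the same area; the sets
  \<open>J i\<close> again partition \<open>S_set\<close>.\<close>

lemma farey_ext_measure_preserving: "measure_preserving S_measure (farey_ext q)"
  unfolding measure_preserving_def
proof (intro conjI measure_eqI)
  fix B assume "B \<in> sets (distr S_measure S_measure (farey_ext q))"
  then have B: "B \<in> sets S_measure" by simp
  then have B' [measurable]: "B \<in> sets borel" and BS: "B \<subseteq> S_set" by (auto simp: sets_S_measure)
  define J where "J = (\<lambda>i. {z \<in> S_set. fst (flip z) \<in> I_set q (q - 2 - i)})"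
  define V where "V = (\<lambda>i. {z \<in> S_set. fst z \<in> I_set q i \<and> farey_ext q z \<in> B})"
  have "J i = (\<lambda>z. fst (flip z)) -` I_set q (q - 2 - i) \<inter> space S_measure" for i
    by (auto simp: J_def)
  moreover have "(\<lambda>z. fst (flip z)) \<in> borel_measurable S_measure"
    by (rule measurable_compose[OF flip_measurable]) (use fst_S_measure in \<open>simp add: measurable_restrict_space2_iff\<close>)
  ultimately have "J i \<in> sets S_measure" for i
    by (metis measurable_sets I_set_borel)
  then have J [measurable]: "J i \<in> sets borel" for i by (simp add: sets_S_measure)
  have V_eq: "V i = {z. fst z \<in> {cut q (Suc i)<..cut q i} \<and>
      (branch i (fst z), snd z / (1 / (rho q i (fst z))\<^sup>2) + shift i (fst z)) \<in> B \<inter> J i}" (is "_ = ?D")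
    if i: "i \<le> q - 2" for i
  proof (intro set_eqI iffI)
    fix z assume "z \<in> V i"
    then have z: "z \<in> S_set" "fst z \<in> I_set q i" "farey_ext q z \<in> B" by (auto simp: V_def)
    have "farey_ext q z \<in> B \<inter> J i"
      using z farey_ext_reversible(1)[OF q3 z(1) i z(2)] farey_ext_in_S[OF q3 z(1)] by (simp add: J_def)
    then show "z \<in> ?D"
      using z(2) unfolding farey_ext_branch[OF i z(2,1)] I_set_cut[OF q3]
      by (simp add: mult.commute)
  next
    fix z assume "z \<in> ?D"
    then have zI: "fst z \<in> I_set q i" and w: "(branch i (fst z), (rho q i (fst z))\<^sup>2 * snd z + shift i (fst z)) \<in> B \<inter> J i" (is "?w \<in> _")
      by (auto simp: I_set_cut[OF q3, symmetric] mult.commute)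
    then have wS: "?w \<in> S_set" and wJ: "fst (flip ?w) \<in> I_set q (q - 2 - i)" by (auto simp: J_def)
    \<comment> \<open>That \<open>z\<close> lies in \<open>S_set\<close> has yet to be shown. The
      preimage \<open>u\<close> of \<open>?w\<close> does lie there, and injectivity of the branch
      and of the fibre map gives \<open>u = z\<close>.\<close>
    define u where "u = farey_inv ?w"
    have uS: "u \<in> S_set" unfolding u_def using wS by (intro flip_in_S farey_ext_in_S[OF q3])
    have "q - 2 - (q - 2 - i) = i" using i by simp
    moreover have "fst u \<in> I_set q (q - 2 - (q - 2 - i))"
      unfolding u_def using wJ by (intro farey_ext_reversible(1)[OF q3]) (auto intro: flip_in_S wS)
    ultimately have uI: "fst u \<in> I_set q i" by (simp only:)
    have "farey_ext q u = ?w" unfolding u_def by (rule farey_inv_right[OF wS])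
    then have e: "branch i (fst u) = branch i (fst z)"
      "(rho q i (fst u))\<^sup>2 * snd u + shift i (fst u) = (rho q i (fst z))\<^sup>2 * snd z + shift i (fst z)"
      using farey_ext_branch[OF i uI uS] by auto
    have f: "fst u = fst z" using branch_inj[OF i uI zI e(1)] .
    then have "snd u = snd z" using e(2) rho_pos[OF q3 i uI] by simp
    then have "u = z" using f by (simp add: prod_eq_iff)
    then show "z \<in> V i" using uS uI w farey_ext_branch[OF i uI uS] by (auto simp: V_def)
  qed
  have V_meas: "V i \<in> sets borel" if "i \<le> q - 2" for i
    unfolding V_eq[OF that] by (rule skew_product_vimage_borel) measurable
  have V_em: "emeasure lborel (V i) = emeasure lborel (B \<inter> J i)" if i: "i \<le> q - 2" for i
    unfolding V_eq[OF i]
  proof (rule emeasure_skew_product)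
    have "fst z \<in> {0<..1}" if "z \<in> B" for z using that BS S_set_fst[OF q3] by blast
    then show "fst ` (B \<inter> J i) \<subseteq> {branch i (cut q (Suc i))..branch i (cut q i)}"
      by (force simp: branch_ends[OF i])
    show "continuous_on {cut q (Suc i)..cut q i} (\<lambda>a. 1 / (rho q i a)\<^sup>2)"
      unfolding rho_def using rho_pos_closed[OF i, unfolded rho_def]
      by (intro continuous_intros) (auto simp: less_le)
    show "0 < 1 / (rho q i a)\<^sup>2" if "a \<in> {cut q (Suc i)..cut q i}" for a
      using rho_pos_closed[OF i that] by simp
  qed (use cut_less[OF q3 i] branch_deriv[OF i] in auto)
  have "farey_ext q -` B \<inter> S_set = (\<Union>i\<in>{..q - 2}. V i)"
    using cell_index[OF q3 S_set_fst[OF q3]] by (force simp: V_def)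
  then have "emeasure (distr S_measure S_measure (farey_ext q)) B = emeasure lborel (\<Union>i\<in>{..q - 2}. V i)"
    using B by (simp add: emeasure_distr) (subst emeasure_S_measure; auto simp: V_def)
  also have "\<dots> = (\<Sum>i\<le>q - 2. emeasure lborel (V i))"
    using V_meas by (intro sum_emeasure[symmetric])
      (auto simp: disjoint_family_on_def V_def dest: I_set_disjoint[OF q3])
  also have "\<dots> = (\<Sum>i\<le>q - 2. emeasure lborel (B \<inter> J i))"
    by (simp add: V_em)
  also have "\<dots> = emeasure lborel (\<Union>i\<in>{..q - 2}. B \<inter> J i)"
  proof (intro sum_emeasure)
    have "i = j" if "i \<le> q - 2" "j \<le> q - 2" "a \<in> I_set q (q - 2 - i)" "a \<in> I_set q (q - 2 - j)" for i j a
      using I_set_disjoint[OF q3 _ _ that(3,4)] that by arith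
    then show "disjoint_family_on (\<lambda>i. B \<inter> J i) {..q - 2}"
      by (auto simp: disjoint_family_on_def J_def)
  qed auto
  also have "(\<Union>i\<in>{..q - 2}. B \<inter> J i) = B"
  proof -
    have "\<exists>i\<le>q - 2. z \<in> J i" if "z \<in> B" for z
    proof -
      have z: "z \<in> S_set" using that BS by auto
      obtain j where j: "j \<le> q - 2" "fst (flip z) \<in> I_set q j"
        using I_set_cover[OF q3 S_set_fst[OF q3 flip_in_S[OF z]]] .
      have "q - 2 - (q - 2 - j) = j" using j by simp
      then have "z \<in> J (q - 2 - j)" unfolding J_def using z j by (simp only:) simp
      then show ?thesis by (intro exI[of _ "q - 2 - j"]) simp
    qed
    then show ?thesis by auto
  qed
  finally show "emeasure (distr S_measure S_measure (farey_ext q)) B = emeasure S_measure B"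
    using BS by (simp add: emeasure_S_measure)
qed auto

lemma farey_inv_measure_preserving: "measure_preserving S_measure farey_inv"
proof -
  have [measurable]: "farey_inv \<in> S_measure \<rightarrow>\<^sub>M S_measure" by measurable
  have "distr S_measure S_measure farey_inv = distr (distr S_measure S_measure (farey_ext q)) S_measure farey_inv"
    using farey_ext_measure_preserving by (simp add: measure_preserving_def)
  also have "\<dots> = distr S_measure S_measure (\<lambda>z. farey_inv (farey_ext q z))"
    by (subst distr_distr) (auto simp: o_def)
  also have "\<dots> = distr S_measure S_measure (\<lambda>z. z)"
    by (intro distr_cong) (auto simp: farey_inv_left)
  finally show ?thesis by (simp add: measure_preserving_def distr_id)
qed

lemma iterate_farey_inv: "z \<in> S_set \<Longrightarrow> (farey_inv ^^ n) z = flip ((farey_ext q ^^ n) (flip z)) \<and> (farey_inv ^^ n) z \<in> S_set"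
  by (induction n) (auto simp: flip_flip iterate_farey_ext[OF q3] flip_in_S farey_ext_in_S[OF q3])

lemma iterate_farey_inv_cancel:
  "z \<in> S_set \<Longrightarrow> (farey_ext q ^^ n) ((farey_inv ^^ n) z) = z"
  "z \<in> S_set \<Longrightarrow> (farey_inv ^^ n) ((farey_ext q ^^ n) z) = z"
proof (induction n arbitrary: z)
  case (Suc n)
  { case 1
    have "(farey_ext q ^^ Suc n) ((farey_inv ^^ Suc n) z) = (farey_ext q ^^ n) (farey_ext q (farey_inv ((farey_inv ^^ n) z)))"
      by (subst funpow_Suc_right) simp
    also have "\<dots> = z"
      using farey_inv_right[OF conjunct2[OF iterate_farey_inv[OF 1]], of n] Suc(1)[OF 1] by (simp only:)
    finally show ?case . }
  { case 2
    have "(farey_inv ^^ Suc n) ((farey_ext q ^^ Suc n) z) = (farey_inv ^^ n) (farey_inv (farey_ext q ((farey_ext q ^^ n) z)))"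
      by (subst funpow_Suc_right) simp
    also have "\<dots> = z"
      using farey_inv_left[OF iterate_farey_ext(1)[OF q3 2], of n] Suc(2)[OF 2] by (simp only:)
    finally show ?case . }
qed auto

lemma regular_set_measurable: "regular_set q \<in> sets S_measure"
proof -
  have fun_pow [measurable]: "(farey_ext q ^^ n) \<in> S_measure \<rightarrow>\<^sub>M S_measure" for n
    using measure_preserving_funpow[OF farey_ext_measure_preserving] by (simp add: measure_preserving_def)
  have [measurable]: "fst \<in> borel_measurable S_measure"
    using fst_S_measure by (simp add: measurable_restrict_space2_iff)
  have "regular_set q = {z \<in> space S_measure. \<forall>n. fst ((farey_ext q ^^ n) z) < 1 \<and> fst ((farey_ext q ^^ n) (flip z)) < 1}"
    by (simp add: regular_set_def)
  also have "\<dots> \<in> sets S_measure" by measurable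
  finally show ?thesis .
qed

text \<open>The lines \<open>a = 1\<close> and \<open>s = 0\<close> are null, hence so are their
  preimages under all iterates of the map and of its inverse. For the inverse iterates,
  \<open>s \<noteq> 0\<close> keeps the first coordinate of the flipped point away from 1.\<close>

lemma AE_regular: "AE z in S_measure. z \<in> regular_set q"
proof -
  have null: "AE z in S_measure. fst z \<noteq> 1 \<and> snd z \<noteq> 0"
  proof -
    have "AE z in lborel \<Otimes>\<^sub>M lborel. fst z \<noteq> (1::real) \<and> snd z \<noteq> (0::real)"
    proof (rule lborel_pair.AE_pair_measure)
      show "{z \<in> space (lborel \<Otimes>\<^sub>M lborel). fst z \<noteq> (1::real) \<and> snd z \<noteq> (0::real)} \<in> sets (lborel \<Otimes>\<^sub>M lborel)"
        by measurable
      show "AE x in lborel. AE y in lborel. fst (x, y) \<noteq> (1::real) \<and> snd (x, y) \<noteq> (0::real)"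
        using AE_lborel_singleton[of "1 :: real"] AE_lborel_singleton[of "0 :: real"]
        by (auto elim!: eventually_mono)
    qed
    then have "AE z in lborel. fst z \<noteq> (1::real) \<and> snd z \<noteq> (0::real)"
      unfolding lborel_prod .
    then show ?thesis unfolding S_measure_def
      by (subst AE_restrict_space_iff) (auto elim: eventually_mono)
  qed
  have S: "AE z in S_measure. z \<in> S_set" using AE_space[of S_measure] by simp
  have "AE z in S_measure. fst ((farey_ext q ^^ n) z) < 1 \<and> fst ((farey_ext q ^^ n) (flip z)) < 1" for n
    using measure_preserving_AE[OF measure_preserving_funpow[OF farey_ext_measure_preserving] null, of n]
      measure_preserving_AE[OF measure_preserving_funpow[OF farey_inv_measure_preserving] null, of n] S
  proof eventually_elim
    case (elim z)
    have 1: "(farey_ext q ^^ n) z \<in> S_set" using elim iterate_farey_ext[OF q3] by simp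
    have 2: "(farey_inv ^^ n) z \<in> S_set" "(farey_ext q ^^ n) (flip z) = flip ((farey_inv ^^ n) z)"
      using iterate_farey_inv[OF elim(3), of n] iterate_farey_ext(1)[OF q3 flip_in_S[OF elim(3)]]
      by (auto simp: flip_flip)
    have "fst (flip ((farey_inv ^^ n) z)) \<noteq> 1"
      using fst_flip_eq_1[of "fst ((farey_inv ^^ n) z)" "snd ((farey_inv ^^ n) z)"] 2(1) elim(2) by simp
    then show ?case
      using elim S_set_fst[OF q3 1] S_set_fst[OF q3 flip_in_S[OF 2(1)]] unfolding 2(2) by auto
  qed
  then have "AE z in S_measure. \<forall>n. fst ((farey_ext q ^^ n) z) < 1 \<and> fst ((farey_ext q ^^ n) (flip z)) < 1"
    by (simp add: AE_all_countable)
  then show ?thesis using S by eventually_elim (simp add: regular_set_def)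
qed

end


section \<open>The accelerated map\<close>

text \<open>With \<open>l = hecke_lambda q\<close>, the left side is the length of a fibre of
  \<open>R_set\<close> over the last cell and the right side the density there.\<close>

lemma reciprocal_diff:
  fixes a l :: real
  assumes "0 < a" "a < 1" "0 \<le> l"
  shows "1 / (a * (1 - a)) - 1 / (a * (l * a + (1 - a))) = l / ((1 - a) * ((1 - a) + l * a))"
proof -
  define b c where "b = 1 - a" and "c = l * a + (1 - a)"
  have nz: "a \<noteq> 0" "b \<noteq> 0" "c \<noteq> 0"
    using assms by (auto simp: b_def c_def intro!: add_nonneg_pos less_imp_neq[THEN not_sym])
  have "1 / (a * b) - 1 / (a * c) = (c - b) / (a * b * c)"
    using nz by (simp add: field_simps)
  also have "c - b = l * a" by (simp add: b_def c_def)
  also have "l * a / (a * b * c) = l / (b * c)" using nz by simp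
  finally show ?thesis by (simp add: b_def c_def add.commute)
qed

context
  fixes q :: nat
  assumes q3: "q \<ge> 3"
begin

lemma space_gauss_measure: "space (gauss_measure q) = {0<..1}"
  and sets_gauss_measure: "sets (gauss_measure q) = sets (restrict_space borel {0<..1})"
  by (simp_all add: gauss_measure_def space_restrict_space cong: sets_restrict_space_cong)

section \<open>Measurability and invariance for the accelerated maps\<close>

lemma farey_iterate_measurable [measurable]:
  "(farey q ^^ n) \<in> restrict_space borel {0<..1} \<rightarrow>\<^sub>M restrict_space borel {0<..1}"
  using farey_measurable[OF q3] by (rule measurable_compose_n)

lemma farey_ext_iterate_measurable [measurable]: "(farey_ext q ^^ n) \<in> S_measure \<rightarrow>\<^sub>M S_measure"
  using farey_ext_measurable[OF q3] by (rule measurable_compose_n)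

lemma exit_time_measurable [measurable]:
  "exit_time q i \<in> restrict_space borel {0<..1} \<rightarrow>\<^sub>M count_space UNIV"
proof -
  have [measurable]: "(farey q ^^ n) \<in> borel_measurable (restrict_space borel {0<..1})" for n
    using farey_iterate_measurable[of n] by (simp add: measurable_restrict_space2_iff)
  note [measurable] = I_set_borel[OF q3]
  show ?thesis
    unfolding exit_time_def[abs_def] by measurable
qed

lemma return_time_measurable [measurable]:
  "return_time q \<in> restrict_space borel {0<..1} \<rightarrow>\<^sub>M count_space UNIV"
proof -
  have [measurable]: "(\<lambda>a. a) \<in> borel_measurable (restrict_space borel {0<..1::real})"
    by (rule measurable_restrict_space1) simp
  note [measurable] = I_set_borel[OF q3]
  show ?thesis
    unfolding return_time_def[abs_def] by measurable
qed

lemma gauss_measurable [measurable]: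
  "gauss q \<in> restrict_space borel {0<..1} \<rightarrow>\<^sub>M restrict_space borel {0<..1}"
  unfolding gauss_eq[abs_def]
  by (rule measurable_compose_countable[OF farey_iterate_measurable return_time_measurable])

lemma gauss_ext_measurable [measurable]: "gauss_ext q \<in> S_measure \<rightarrow>\<^sub>M S_measure"
  unfolding gauss_ext_eq[abs_def]
  by (rule measurable_compose_countable[OF farey_ext_iterate_measurable
        measurable_compose[OF fst_S_measure return_time_measurable]])

lemma R_set_S_measure [measurable]: "R_set q \<in> sets S_measure"
proof -
  have [measurable]: "fst \<in> borel_measurable S_measure"
    using fst_S_measure by (simp add: measurable_restrict_space2_iff)
  note [measurable] = I_set_borel[OF q3]
  have "R_set q = {z \<in> space S_measure. \<not> (fst z \<in> I_set q (q - 2) \<and> fst (flip z) \<in> I_set q 0)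
     \<and> \<not> (fst z \<in> I_set q 0 \<and> fst (flip z) \<in> I_set q (q - 2))}"
    using R_set_iff[OF q3] by auto
  also have "\<dots> \<in> sets S_measure" by measurable
  finally show ?thesis .
qed

lemma core_set_S_measure [measurable]: "core_set q \<in> sets S_measure"
  using regular_set_measurable[OF q3] by auto

lemma Int_space_S_measure:
  "R_set q \<inter> space S_measure \<in> sets S_measure" "core_set q \<inter> space S_measure \<in> sets S_measure"
  by (simp_all only: sets.Int_space_eq2 R_set_S_measure core_set_S_measure)

lemma R_measure_eq: "R_measure q = restrict_space S_measure (R_set q)"
proof -
  have "S_set \<inter> R_set q = R_set q" using R_set_subset[OF q3] by auto
  moreover have "R_set q \<in> sets borel" using R_set_S_measure by (simp add: sets_S_measure)
  ultimately show ?thesis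
    unfolding R_measure_def S_measure_def by (subst restrict_restrict_space) auto
qed

lemma space_R_measure: "space (R_measure q) = R_set q"
  by (simp add: R_measure_def space_restrict_space)

lemma sets_R_measure: "A \<in> sets (R_measure q) \<longleftrightarrow> A \<in> sets S_measure \<and> A \<subseteq> R_set q"
  unfolding R_measure_eq sets_restrict_space_iff[OF Int_space_S_measure(1)] by auto

lemma emeasure_R_measure: "A \<subseteq> R_set q \<Longrightarrow> emeasure (R_measure q) A = emeasure S_measure A"
  unfolding R_measure_eq by (rule emeasure_restrict_space[OF Int_space_S_measure(1)])

lemma gauss_ext_R_measurable: "gauss_ext q \<in> R_measure q \<rightarrow>\<^sub>M R_measure q"
  unfolding R_measure_eq using gauss_ext_in_R[OF q3]
  by (intro measurable_restrict_space3 gauss_ext_measurable) auto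

lemma emeasure_inter_core_set:
  assumes "A \<in> sets S_measure"
  shows "emeasure S_measure (A \<inter> R_set q) = emeasure S_measure (A \<inter> core_set q)"
  using assms AE_regular[OF q3] by (intro emeasure_eq_AE) (auto elim!: eventually_mono)

lemma core_set_conull: "core_set q \<in> sets (R_measure q)" "space (R_measure q) - core_set q \<in> null_sets (R_measure q)"
proof -
  show *: "core_set q \<in> sets (R_measure q)" by (simp add: sets_R_measure)
  have "emeasure (R_measure q) (R_set q - core_set q) = emeasure S_measure ((R_set q - core_set q) \<inter> R_set q)"
    by (subst emeasure_R_measure) (auto intro!: arg_cong[where f = "emeasure S_measure"])
  also have "\<dots> = emeasure S_measure ((R_set q - core_set q) \<inter> core_set q)"
    by (rule emeasure_inter_core_set) measurable
  also have "(R_set q - core_set q) \<inter> core_set q = {}" by auto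
  finally show "space (R_measure q) - core_set q \<in> null_sets (R_measure q)"
    using * by (intro null_setsI) (auto simp: space_R_measure sets_R_measure)
qed

text \<open>On \<open>core_set q\<close> the map is a power of the invertible map \<open>farey_ext q\<close> on each of the countably
  many level sets of the return time, and the images of these level sets partition \<open>core_set q\<close>.\<close>

lemma gauss_ext_measure_preserving: "measure_preserving (R_measure q) (gauss_ext q)"
  unfolding measure_preserving_def
proof (intro conjI measure_eqI gauss_ext_R_measurable)
  fix B assume "B \<in> sets (distr (R_measure q) (R_measure q) (gauss_ext q))"
  then have B: "B \<in> sets (R_measure q)" by simp
  then have BS [measurable]: "B \<in> sets S_measure" and BR: "B \<subseteq> R_set q"
    by (auto simp: sets_R_measure)
  let ?I = "\<lambda>n. (\<lambda>z. flip (farey_ext q (flip z))) ^^ n"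
  have I_mp: "measure_preserving S_measure (?I n)" for n
    by (rule measure_preserving_funpow[OF farey_inv_measure_preserving[OF q3]])
  then have I_meas [measurable]: "?I n \<in> S_measure \<rightarrow>\<^sub>M S_measure" for n
    by (simp add: measure_preserving_def)
  define A where "A = (\<lambda>n. {z \<in> core_set q. return_time q (fst z) = n})"
  define D where "D = (\<lambda>n. {z \<in> A n. (farey_ext q ^^ n) z \<in> B})"
  \<comment> \<open>\<open>E n\<close> is the image of \<open>D n\<close> under the
    \<open>n\<close>-th iterate, written through the inverse iterate: as a preimage it is
    measurable, and invariance gives it the measure of \<open>D n\<close>.\<close>
  define E where "E = (\<lambda>n. {w \<in> S_set. ?I n w \<in> A n \<and> w \<in> B})"
  have core_S: "core_set q \<subseteq> S_set" using R_set_subset[OF q3] by auto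
  have [measurable]: "A n \<in> sets S_measure" for n
  proof -
    have "A n = core_set q \<inter> {z \<in> space S_measure. return_time q (fst z) = n}"
      using core_S by (auto simp: A_def)
    also have "\<dots> \<in> sets S_measure" by measurable
    finally show ?thesis .
  qed
  have D_sets: "D n \<in> sets S_measure" for n
  proof -
    have "D n = A n \<inter> {z \<in> space S_measure. (farey_ext q ^^ n) z \<in> B}"
      using core_S by (auto simp: D_def A_def)
    also have "\<dots> \<in> sets S_measure" by measurable
    finally show ?thesis .
  qed
  have E_eq: "E n = ?I n -` D n \<inter> space S_measure" for n
    using iterate_farey_inv_cancel(1)[OF q3, of _ n] by (auto simp: E_def D_def)
  have E_sets: "E n \<in> sets S_measure" for n
    unfolding E_eq by (intro measurable_sets[OF I_meas] D_sets)
  have DE: "emeasure S_measure (D n) = emeasure S_measure (E n)" for n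
    unfolding E_eq using I_mp[of n] D_sets[of n] emeasure_distr[OF I_meas, of "D n" n]
    by (simp add: measure_preserving_def)
  have E_iff: "w \<in> E n \<longleftrightarrow> w \<in> B \<and> (\<exists>z\<in>A n. gauss_ext q z = w)" for w n
  proof
    assume w: "w \<in> E n"
    then have "(farey_ext q ^^ n) (?I n w) = w" using iterate_farey_inv_cancel(1)[OF q3] by (simp add: E_def)
    moreover have "?I n w \<in> A n" "w \<in> B" using w by (auto simp: E_def)
    ultimately show "w \<in> B \<and> (\<exists>z\<in>A n. gauss_ext q z = w)"
      by (intro conjI bexI[of _ "?I n w"]) (auto simp: A_def gauss_ext_eq)
  next
    assume "w \<in> B \<and> (\<exists>z\<in>A n. gauss_ext q z = w)"
    then obtain z where z: "w \<in> B" "z \<in> A n" "w = (farey_ext q ^^ n) z"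
      by (auto simp: A_def gauss_ext_eq)
    then have "z \<in> S_set" using core_S by (auto simp: A_def)
    then have "?I n w = z" using iterate_farey_inv_cancel(2)[OF q3, of z n] z(3) by simp
    then show "w \<in> E n" using z BR R_set_subset[OF q3] by (auto simp: E_def)
  qed
  have inj: "inj_on (gauss_ext q) (core_set q)" and surj: "gauss_ext q ` core_set q = core_set q"
    using gauss_ext_bij[OF q3] by (auto simp: bij_betw_def)
  have "emeasure (distr (R_measure q) (R_measure q) (gauss_ext q)) B = emeasure S_measure (gauss_ext q -` B \<inter> R_set q)"
    using B by (simp add: emeasure_distr[OF gauss_ext_R_measurable] emeasure_R_measure space_R_measure)
  also have "\<dots> = emeasure S_measure ((gauss_ext q -` B \<inter> space S_measure) \<inter> R_set q)"
    using R_set_subset[OF q3] by (intro arg_cong[where f = "emeasure S_measure"]) auto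
  also have "\<dots> = emeasure S_measure ((gauss_ext q -` B \<inter> space S_measure) \<inter> core_set q)"
    by (intro emeasure_inter_core_set) measurable
  also have "(gauss_ext q -` B \<inter> space S_measure) \<inter> core_set q = (\<Union>n. D n)"
    using core_S by (auto simp: D_def A_def gauss_ext_eq)
  also have "emeasure S_measure \<dots> = (\<Sum>n. emeasure S_measure (D n))"
    using D_sets by (intro suminf_emeasure[symmetric]) (auto simp: disjoint_family_on_def D_def A_def)
  also have "\<dots> = (\<Sum>n. emeasure S_measure (E n))"
    by (simp add: DE)
  also have "\<dots> = emeasure S_measure (\<Union>n. E n)"
  proof (intro suminf_emeasure)
    show "disjoint_family E"
      unfolding disjoint_family_on_def
    proof safe
      fix m n w assume mn: "m \<noteq> n" and w: "w \<in> E m" "w \<in> E n"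
      obtain z1 z2 where z1: "z1 \<in> A m" "gauss_ext q z1 = w" and z2: "z2 \<in> A n" "gauss_ext q z2 = w"
        using w(1)[unfolded E_iff] w(2)[unfolded E_iff] by auto
      moreover have "z1 = z2" using inj z1 z2 unfolding A_def inj_on_def by auto
      ultimately show "w \<in> {}" using mn by (simp add: A_def)
    qed
  qed (use E_sets in auto)
  also have "(\<Union>n. E n) = B \<inter> core_set q"
  proof (intro set_eqI iffI)
    fix w assume "w \<in> (\<Union>n. E n)"
    then show "w \<in> B \<inter> core_set q" using gauss_ext_in_core_set[OF q3] unfolding UN_iff E_iff A_def by blast
  next
    fix w assume w: "w \<in> B \<inter> core_set q"
    then obtain z where "z \<in> core_set q" "gauss_ext q z = w" using surj by (metis IntD2 imageE)
    then show "w \<in> (\<Union>n. E n)" using w unfolding UN_iff E_iff A_def by blast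
  qed
  also have "emeasure S_measure (B \<inter> core_set q) = emeasure S_measure (B \<inter> R_set q)"
    by (rule emeasure_inter_core_set[symmetric]) measurable
  also have "B \<inter> R_set q = B" using BR by auto
  finally show "emeasure (distr (R_measure q) (R_measure q) (gauss_ext q)) B = emeasure (R_measure q) B"
    using BR by (simp add: emeasure_R_measure)
qed simp

section \<open>Fibres of \<open>R_set\<close> and the invariant density\<close>

lemma sin_quot_special:
  "sin_quot q (Suc (Suc 0)) = hecke_lambda q" "sin_quot q (q - 2) = hecke_lambda q"
  "sin_quot q (Suc (q - 2)) = 1" "sin_quot q (Suc (Suc (q - 2))) = 0"
  using sin_quot_dual[OF q3, of 0] by (simp_all add: sq_simps[OF q3] sin_quot_rec[OF q3])

text \<open>All constants come from \<open>1 \<le> hecke_lambda q\<close> and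
  \<open>hecke_lambda q < 2\<close>; they keep each piece of the density away from its
  poles.\<close>

lemma I_set_bounds:
  "a \<in> I_set q 0 \<Longrightarrow> 1/2 \<le> a \<and> a \<le> 1"
  "a \<in> I_set q (q - 2) \<Longrightarrow> 0 < a \<and> a \<le> 1/2"
  "a \<in> {0<..1} \<Longrightarrow> a \<notin> I_set q 0 \<Longrightarrow> a \<notin> I_set q (q - 2) \<Longrightarrow> 1/3 \<le> a \<and> a \<le> 2/3"
proof -
  let ?L = "hecke_lambda q"
  have L: "1 \<le> ?L" "?L < 2" using hecke_lambda_ge_1[OF q3] hecke_lambda_less_2[OF q3] by auto
  then have *: "1/2 \<le> ?L / (?L + 1)" "?L / (?L + 1) \<le> 2/3" "1 / (?L + 1) \<le> 1/2" "1/3 \<le> 1 / (?L + 1)"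
    by (simp_all add: field_simps)
  show "a \<in> I_set q 0 \<Longrightarrow> 1/2 \<le> a \<and> a \<le> 1"
    "a \<in> I_set q (q - 2) \<Longrightarrow> 0 < a \<and> a \<le> 1/2"
    "a \<in> {0<..1} \<Longrightarrow> a \<notin> I_set q 0 \<Longrightarrow> a \<notin> I_set q (q - 2) \<Longrightarrow> 1/3 \<le> a \<and> a \<le> 2/3"
    unfolding I_set_0[OF q3] I_set_last[OF q3] using * by (auto simp only: greaterThanAtMost_iff; linarith)+
qed

text \<open>Over the first cell \<open>R_set\<close> lacks the top strip
  \<open>H_set q (q - 2)\<close>, over the last cell the bottom strip \<open>H_set q 0\<close>, and
  over the others nothing is removed. In each case the fibre is an interval.\<close>

lemma R_fibre:
  assumes a: "a \<in> {0<..1}"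
  shows "emeasure lborel {s. (a, s) \<in> R_set q} = ennreal (gauss_density q a)"
proof -
  let ?L = "hecke_lambda q"
  have L: "1 \<le> ?L" using hecke_lambda_ge_1[OF q3] .
  have a0: "0 < a" "a \<le> 1" using a by auto
  have H: "(a, s) \<in> H_set q i \<longleftrightarrow>
      sin_quot q i \<le> s * a * (sin_quot q (Suc i) * a + sin_quot q i * (1 - a)) \<and>
      s * a * (sin_quot q (Suc (Suc i)) * a + sin_quot q (Suc i) * (1 - a)) < sin_quot q (Suc i)"
    if "(a, s) \<in> S_set" "i \<le> q - 2" for s i
    using R_fun_le_iff[OF q3 _ that(1), of i] R_fun_le_iff[OF q3 _ that(1), of "Suc i"] that q3
    by (auto simp: H_set_def not_le[symmetric])
  consider "a \<in> I_set q 0" | "a \<in> I_set q (q - 2)" "a \<notin> I_set q 0" | "a \<notin> I_set q 0" "a \<notin> I_set q (q - 2)"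
    by blast
  then show ?thesis
  proof cases
    case 1
    have D: "0 < a * (a + ?L * (1 - a))" using a0 L by (auto intro!: mult_pos_pos add_pos_nonneg)
    have "{s. (a, s) \<in> R_set q} = {0..<?L / (a * (a + ?L * (1 - a)))}"
    proof (intro set_eqI)
      fix s
      have "(a, s) \<in> R_set q \<longleftrightarrow> (a, s) \<in> S_set \<and> s * a * (a + ?L * (1 - a)) < ?L"
        using H[of s "q - 2"] first_last_distinct[OF q3 1] 1 
        unfolding R_set_def V_set_def sin_quot_special by (auto simp: S_set_iff)
      also have "\<dots> \<longleftrightarrow> 0 \<le> s \<and> s * a * (a + ?L * (1 - a)) < ?L"
      proof -
        \<comment> \<open>The new upper bound implies the one of \<open>S_set\<close>: the summand
          \<open>a\<close> is dropped from \<open>a + ?L * (1 - a)\<close>, and \<open>?L\<close> is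
          cancelled.\<close>
        have "s * a * (1 - a) < 1" if "0 \<le> s" "s * a * (a + ?L * (1 - a)) < ?L"
        proof -
          have "s * a * (?L * (1 - a)) \<le> s * a * (a + ?L * (1 - a))"
            using that a0 by (intro mult_left_mono) auto
          then have "?L * (s * a * (1 - a)) < ?L * 1" using that(2) by (simp add: algebra_simps)
          then show ?thesis using L by (simp only: mult_less_cancel_left_pos)
        qed
        then show ?thesis using a0 by (auto simp: S_set_iff)
      qed
      also have "\<dots> \<longleftrightarrow> s \<in> {0..<?L / (a * (a + ?L * (1 - a)))}"
        using D by (simp add: less_divide_eq mult.assoc)
      finally show "s \<in> {s. (a, s) \<in> R_set q} \<longleftrightarrow> s \<in> {0..<?L / (a * (a + ?L * (1 - a)))}" by simp
    qed
    moreover have "0 \<le> ?L / (a * (a + ?L * (1 - a)))" using L D by simp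
    ultimately show ?thesis using 1 by (simp add: gauss_density_def)
  next
    case 2
    have a1: "a \<le> 1/2" using I_set_bounds(2)[OF 2(1)] by simp
    have D: "0 < a * (?L * a + (1 - a))" "0 < a * (1 - a)" using a0 a1 L by (auto intro!: mult_pos_pos add_pos_nonneg)
    have "{s. (a, s) \<in> R_set q} = {1 / (a * (?L * a + (1 - a)))..<1 / (a * (1 - a))}"
    proof (intro set_eqI)
      fix s
      have "(a, s) \<in> R_set q \<longleftrightarrow> (a, s) \<in> S_set \<and> 1 \<le> s * a * (?L * a + (1 - a))"
        using H[of s 0] 2 a0 unfolding R_set_def V_set_def sin_quot_special
        by (auto simp: S_set_iff sq_simps[OF q3])
      also have "\<dots> \<longleftrightarrow> 1 / (a * (?L * a + (1 - a))) \<le> s \<and> s < 1 / (a * (1 - a))"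
      proof -
        have "0 \<le> s" if "1 / (a * (?L * a + (1 - a))) \<le> s"
          using that D(1) by (meson dual_order.trans less_imp_le zero_le_divide_1_iff)
        then show ?thesis using D a0 by (auto simp: S_set_iff divide_le_eq less_divide_eq mult.assoc)
      qed
      finally show "s \<in> {s. (a, s) \<in> R_set q} \<longleftrightarrow> s \<in> {1 / (a * (?L * a + (1 - a)))..<1 / (a * (1 - a))}" by simp
    qed
    moreover have "1 / (a * (?L * a + (1 - a))) \<le> 1 / (a * (1 - a))"
      using D a0 L by (intro frac_le mult_left_mono) auto
    moreover have "1 / (a * (1 - a)) - 1 / (a * (?L * a + (1 - a))) = ?L / ((1 - a) * ((1 - a) + ?L * a))"
      using a0 a1 L by (intro reciprocal_diff) auto
    ultimately show ?thesis using 2 by (simp add: gauss_density_def)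
  next
    case 3
    have a1: "a \<le> 2/3" using I_set_bounds(3)[OF a 3] by simp
    have D: "0 < a * (1 - a)" using a0 a1 by simp
    have "{s. (a, s) \<in> R_set q} = {0..<1 / (a * (1 - a))}"
      using 3 a0 D by (auto simp: R_set_def V_set_def S_set_iff less_divide_eq mult.assoc)
    then show ?thesis using 3 D by (simp add: gauss_density_def)
  qed
qed

text \<open>The constant comes from the middle piece, where both factors are at least 1/3. On the
  end pieces the estimate gives 4, and replacing \<open>a\<close> by \<open>1 - a\<close> exchanges
  their formulas.\<close>

lemma gauss_density_le: "a \<in> {0<..1} \<Longrightarrow> gauss_density q a \<le> 9"
proof -
  assume a: "a \<in> {0<..1}"
  let ?L = "hecke_lambda q"
  have L: "1 \<le> ?L" "?L < 2" using hecke_lambda_ge_1[OF q3] hecke_lambda_less_2[OF q3] by auto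
  have aux: "?L / (b * (b + ?L * (1 - b))) \<le> 9" if "1/2 \<le> b" "b \<le> 1" for b
  proof -
    have "(1 - b) \<le> ?L * (1 - b)" using that L mult_right_mono[of 1 ?L "1 - b"] by simp
    then have "1/2 * 1 \<le> b * (b + ?L * (1 - b))" using that L by (intro mult_mono) auto
    then show ?thesis using L by (simp add: divide_le_eq)
  qed
  have mid: "1 / (a * (1 - a)) \<le> 9" if "1/3 \<le> a" "a \<le> 2/3"
  proof -
    have "1/3 * (1/3) \<le> a * (1 - a)" using that by (intro mult_mono) auto
    then show ?thesis by (simp add: divide_le_eq)
  qed
  show ?thesis
    using aux[of a] aux[of "1 - a"] mid I_set_bounds[of a] a
    by (auto simp: gauss_density_def)
qed

lemma gauss_density_measurable [measurable]: "gauss_density q \<in> borel_measurable borel"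
proof -
  note [measurable] = I_set_borel[OF q3]
  show ?thesis unfolding gauss_density_def[abs_def] by measurable
qed

lemma finite_gauss_measure: "finite_measure (gauss_measure q)"
proof
  have "emeasure (gauss_measure q) (space (gauss_measure q)) =
      (\<integral>\<^sup>+a. ennreal (gauss_density q a) * indicator {0<..1} a \<partial>restrict_space lborel {0<..1})"
    unfolding space_gauss_measure unfolding gauss_measure_def
    by (rule emeasure_density) (auto simp: sets_restrict_space_iff intro: measurable_restrict_space1)
  also have "\<dots> \<le> (\<integral>\<^sup>+a. 9 \<partial>restrict_space lborel {0<..1::real})"
  proof (rule nn_integral_mono)
    fix a assume "a \<in> space (restrict_space lborel {0<..1::real})"
    then have "gauss_density q a \<le> 9" by (intro gauss_density_le) (simp add: space_restrict_space)
    then have "ennreal (gauss_density q a) \<le> 9"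
      using ennreal_leI by fastforce
    then show "ennreal (gauss_density q a) * indicator {0<..1} a \<le> 9"
      by (auto simp: indicator_def)
  qed
  also have "\<dots> = 9"
    by (simp add: space_restrict_space emeasure_restrict_space)
  finally show "emeasure (gauss_measure q) (space (gauss_measure q)) \<noteq> \<infinity>"
    by (auto simp: top_unique)
qed

lemma fst_R_measurable: "fst \<in> R_measure q \<rightarrow>\<^sub>M gauss_measure q"
  unfolding measurable_cong_sets[OF refl sets_gauss_measure] R_measure_eq
  by (rule measurable_restrict_space1[OF fst_S_measure])

text \<open>By Tonelli, the area over \<open>E\<close> is the integral of the fibre lengths found in
  \<open>R_fibre\<close>.\<close>

lemma distr_fst: "distr (R_measure q) (gauss_measure q) fst = gauss_measure q"
proof (rule measure_eqI)
  fix E assume "E \<in> sets (distr (R_measure q) (gauss_measure q) fst)"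
  then have E: "E \<in> sets (gauss_measure q)" by simp
  then have Eb [measurable]: "E \<in> sets borel" and E01: "E \<subseteq> {0<..1}"
    by (auto simp: sets_gauss_measure sets_restrict_space_iff)
  define A where "A = {z \<in> R_set q. fst z \<in> E}"
  have A_eq: "A = fst -` E \<inter> space (R_measure q)" by (auto simp: A_def space_R_measure)
  have "A \<in> sets (R_measure q)" unfolding A_eq using E by (rule measurable_sets[OF fst_R_measurable])
  then have "A \<in> sets borel" by (auto simp: sets_R_measure sets_S_measure)
  then have A': "A \<in> sets (lborel \<Otimes>\<^sub>M lborel)" unfolding lborel_prod by simp
  have AS: "A \<subseteq> S_set" "A \<subseteq> R_set q" using R_set_subset[OF q3] by (auto simp: A_def)
  have "emeasure (distr (R_measure q) (gauss_measure q) fst) E = emeasure lborel A"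
    using E AS by (simp add: emeasure_distr[OF fst_R_measurable] A_eq[symmetric] emeasure_R_measure emeasure_S_measure)
  also have "\<dots> = (\<integral>\<^sup>+a. emeasure lborel (Pair a -` A) \<partial>lborel)"
    using lborel.emeasure_pair_measure_alt[OF A'] unfolding lborel_prod .
  also have "\<dots> = (\<integral>\<^sup>+a. ennreal (gauss_density q a) * indicator E a * indicator {0<..1} a \<partial>lborel)"
  proof (rule nn_integral_cong)
    fix a
    have "Pair a -` A = (if a \<in> E then {s. (a, s) \<in> R_set q} else {})" by (auto simp: A_def)
    then show "emeasure lborel (Pair a -` A) = ennreal (gauss_density q a) * indicator E a * indicator {0<..1} a"
      using E01 R_fibre[of a] by (auto simp: indicator_def)
  qed
  also have "\<dots> = (\<integral>\<^sup>+a. ennreal (gauss_density q a) * indicator E a \<partial>restrict_space lborel {0<..1})"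
    by (subst nn_integral_restrict_space) auto
  also have "\<dots> = emeasure (gauss_measure q) E"
    unfolding gauss_measure_def using E01 Eb
    by (intro emeasure_density[symmetric]) (auto simp: sets_restrict_space_iff intro: measurable_restrict_space1)
  finally show "emeasure (distr (R_measure q) (gauss_measure q) fst) E = emeasure (gauss_measure q) E" .
qed simp

lemma gauss_measure_preserving: "measure_preserving (gauss_measure q) (gauss q)"
proof -
  let ?N = "gauss_measure q" and ?M = "R_measure q"
  have G: "gauss q \<in> ?N \<rightarrow>\<^sub>M ?N"
    unfolding measurable_cong_sets[OF sets_gauss_measure sets_gauss_measure] by (rule gauss_measurable)
  have T: "distr ?M ?M (gauss_ext q) = ?M" using gauss_ext_measure_preserving by (simp add: measure_preserving_def)
  have "distr ?N ?N (gauss q) = distr (distr ?M ?N fst) ?N (gauss q)" by (simp add: distr_fst)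
  also have "\<dots> = distr ?M ?N (\<lambda>z. gauss q (fst z))"
    by (simp add: distr_distr[OF G fst_R_measurable] o_def)
  also have "\<dots> = distr ?M ?N (\<lambda>z. fst (gauss_ext q z))"
    using R_set_subset[OF q3] by (intro distr_cong) (auto simp: space_R_measure fst_gauss_ext[OF q3])
  also have "\<dots> = distr (distr ?M ?M (gauss_ext q)) ?N fst"
    by (simp add: distr_distr[OF fst_R_measurable gauss_ext_R_measurable] o_def)
  finally show ?thesis using G by (simp add: measure_preserving_def T distr_fst)
qed

section \<open>Reconstruction from the past\<close>

abbreviation (input) gauss_inv :: "real \<times> real \<Rightarrow> real \<times> real" where
  "gauss_inv \<equiv> \<lambda>z. flip (gauss_ext q (flip z))"

lemma gauss_inv_core_set:
  assumes "z \<in> core_set q"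
  shows "(gauss_inv ^^ n) z \<in> core_set q" "(gauss_ext q ^^ n) z \<in> core_set q"
    "(gauss_ext q ^^ n) ((gauss_inv ^^ n) z) = z" "(gauss_inv ^^ n) ((gauss_ext q ^^ n) z) = z"
proof -
  have step: "gauss_inv z \<in> core_set q" "gauss_ext q z \<in> core_set q" if "z \<in> core_set q" for z
    using that by (intro flip_in_core_set[OF q3] gauss_ext_in_core_set[OF q3]; assumption)+
  have fl: "flip (flip z) = z" if "z \<in> core_set q" for z using that R_set_subset[OF q3] by (auto simp: flip_flip)
  have c: "gauss_ext q (gauss_inv z) = z" "gauss_inv (gauss_ext q z) = z" if "z \<in> core_set q" for z
    using gauss_ext_reversible[OF q3 flip_in_core_set[OF q3 that]] gauss_ext_reversible[OF q3 that] fl[OF that] by simp_all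
  have *: "(gauss_inv ^^ n) z \<in> core_set q \<and> (gauss_ext q ^^ n) z \<in> core_set q" for n
    using assms by (induction n) (simp_all only: funpow.simps o_apply step id_apply)
  then show "(gauss_inv ^^ n) z \<in> core_set q" "(gauss_ext q ^^ n) z \<in> core_set q" by auto
  show "(gauss_ext q ^^ n) ((gauss_inv ^^ n) z) = z"
  proof (induction n)
    case (Suc n)
    have "(gauss_ext q ^^ Suc n) ((gauss_inv ^^ Suc n) z) = (gauss_ext q ^^ n) (gauss_ext q (gauss_inv ((gauss_inv ^^ n) z)))"
      by (subst funpow_Suc_right) simp
    then show ?case using c(1)[OF conjunct1[OF *[of n]]] Suc by (simp only:)
  qed simp
  show "(gauss_inv ^^ n) ((gauss_ext q ^^ n) z) = z"
  proof (induction n)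
    case (Suc n)
    have "(gauss_inv ^^ Suc n) ((gauss_ext q ^^ Suc n) z) = (gauss_inv ^^ n) (gauss_inv (gauss_ext q ((gauss_ext q ^^ n) z)))"
      by (subst funpow_Suc_right) simp
    then show ?case using c(2)[OF conjunct2[OF *[of n]]] Suc by (simp only:)
  qed simp
qed

text \<open>The second coordinate is determined by the first coordinates of the past: along the fibre over
  the first coordinate of the \<open>n\<close>-th preimage, the \<open>n\<close>-th iterate contracts, so the point \<open>0\<close> of that
  fibre can replace the unknown second coordinate.\<close>

lemma past_determines_snd:
  assumes z: "z \<in> core_set q"
  shows "(\<lambda>n. snd ((gauss_ext q ^^ n) (fst ((gauss_inv ^^ n) z), 0))) \<longlonglongrightarrow> snd z"
proof -
  define m where "m = min (fst z) (1 - fst z)"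
  have zS: "z \<in> S_set" using z R_set_subset[OF q3] by auto
  have "0 < fst z" "fst z < 1" using S_set_fst[OF q3 zS] regular_less_1[OF q3, of z] z by auto
  then have m: "0 < m" by (simp add: m_def)
  let ?c = "\<lambda>n. snd ((gauss_ext q ^^ n) (fst ((gauss_inv ^^ n) z), 0))"
  have bound: "norm (?c n - snd z) \<le> 1 / real n * (1 / m\<^sup>2)" if n: "0 < n" for n
  proof -
    define w where "w = (gauss_inv ^^ n) z"
    have wC: "w \<in> core_set q" and w: "(gauss_ext q ^^ n) w = z" using gauss_inv_core_set[OF z] by (auto simp: w_def)
    then have wS: "(fst w, snd w) \<in> S_set" using R_set_subset[OF q3] by auto
    then have w0: "(fst w, 0) \<in> S_set" using S_set_fst[OF q3 wS] by (simp add: S_set_iff)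
    obtain k where k: "n \<le> k" "\<And>s. (fst w, s) \<in> S_set \<Longrightarrow> (gauss_ext q ^^ n) (fst w, s) = (farey_ext q ^^ k) (fst w, s)"
      using gauss_ext_iterate_fibre[OF q3 wC, of n] by blast
    have Fk: "(farey_ext q ^^ k) (fst w, snd w) = z" using k(2)[OF wS] w by simp
    then have fk: "(farey q ^^ k) (fst w) = fst z" using iterate_farey_ext(2)[OF q3 wS, of k] by simp
    have "\<bar>snd ((farey_ext q ^^ k) (fst w, 0)) - snd z\<bar> \<le> 1 / (real k * m\<^sup>2)"
      using fibre_contraction[OF q3 w0 wS, of k] n k(1) \<open>fst z < 1\<close> unfolding fk Fk m_def by simp
    also have "\<dots> \<le> 1 / (real n * m\<^sup>2)" using n k(1) m by (intro frac_le mult_right_mono) auto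
    finally show ?thesis using k(2)[OF w0] by (simp add: w_def)
  qed
  have "(\<lambda>n. 1 / real n * (1 / m\<^sup>2)) \<longlonglongrightarrow> 0"
    by (rule tendsto_mult_left_zero[OF lim_inverse_n'])
  then have "(\<lambda>n. ?c n - snd z) \<longlonglongrightarrow> 0"
    by (rule Lim_null_comparison[rotated]) (use bound in \<open>auto intro: eventually_mono[OF eventually_gt_at_top[of 0]]\<close>)
  then show ?thesis by (rule LIM_zero_cancel)
qed

text \<open>The generators are the preimages of Borel sets under the past first coordinates, so
  these are measurable for the generated sigma-algebra. The second coordinate is a pointwise limit
  of measurable functions of them, hence the identity into the Borel space is measurable
  too.\<close>

lemma borel_generated_by_past:
  assumes A: "A \<in> sets (R_measure q)"
  shows "A \<inter> core_set q \<in> sigma_sets (core_set q) {(gauss_ext q ^^ n) ` (fst -` E \<inter> core_set q) | n E. E \<in> sets (gauss_measure q)}"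
    (is "_ \<in> sigma_sets (core_set q) ?G")
proof -
  let ?N = "restrict_space borel {0<..1::real}"
  define \<Sigma> where "\<Sigma> = sigma (core_set q) ?G"
  have G: "?G \<subseteq> Pow (core_set q)" using gauss_inv_core_set(2) by blast
  have sp: "space \<Sigma> = core_set q" and st: "sets \<Sigma> = sigma_sets (core_set q) ?G"
    using G by (auto simp: \<Sigma>_def)
  have past: "(\<lambda>z. fst ((gauss_inv ^^ n) z)) \<in> \<Sigma> \<rightarrow>\<^sub>M ?N" for n
  proof (rule measurableI)
    fix z assume "z \<in> space \<Sigma>"
    then have "(gauss_inv ^^ n) z \<in> S_set" using gauss_inv_core_set(1)[of z n] R_set_subset[OF q3] by (auto simp: sp)
    then show "fst ((gauss_inv ^^ n) z) \<in> space ?N" using S_set_fst[OF q3] by (simp add: space_restrict_space)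
  next
    fix E assume E: "E \<in> sets ?N"
    have "(\<lambda>z. fst ((gauss_inv ^^ n) z)) -` E \<inter> space \<Sigma> = (gauss_ext q ^^ n) ` (fst -` E \<inter> core_set q)"
    proof (intro set_eqI iffI)
      fix z assume "z \<in> (\<lambda>z. fst ((gauss_inv ^^ n) z)) -` E \<inter> space \<Sigma>"
      then have z: "z \<in> core_set q" "fst ((gauss_inv ^^ n) z) \<in> E" by (auto simp: sp)
      then show "z \<in> (gauss_ext q ^^ n) ` (fst -` E \<inter> core_set q)"
        using gauss_inv_core_set(1,3)[OF z(1), of n] by (intro image_eqI[of _ _ "(gauss_inv ^^ n) z"]) auto
    next
      fix z assume "z \<in> (gauss_ext q ^^ n) ` (fst -` E \<inter> core_set q)"
      then obtain w where w: "w \<in> core_set q" "fst w \<in> E" "z = (gauss_ext q ^^ n) w" by auto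
      then show "z \<in> (\<lambda>z. fst ((gauss_inv ^^ n) z)) -` E \<inter> space \<Sigma>"
        using gauss_inv_core_set(2,4)[OF w(1), of n] by (simp only: vimage_eq Int_iff sp)
    qed
    then show "(\<lambda>z. fst ((gauss_inv ^^ n) z)) -` E \<inter> space \<Sigma> \<in> sets \<Sigma>"
      using E unfolding st sets_gauss_measure by (auto intro: sigma_sets.Basic)
  qed
  \<comment> \<open>The points \<open>(a, 0)\<close> are never in \<open>core_set\<close>, since
    their flip lies over \<open>a = 1\<close>; the iterates of \<open>gauss_ext\<close> are
    therefore taken on all of \<open>S_measure\<close>.\<close>
  have zero: "(\<lambda>a. (a, 0)) \<in> ?N \<rightarrow>\<^sub>M S_measure"
    unfolding S_measure_def
  proof (rule measurable_restrict_space2)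
    have "(\<lambda>a::real. (a, 0::real)) \<in> ?N \<rightarrow>\<^sub>M borel \<Otimes>\<^sub>M borel"
      by (intro measurable_Pair measurable_restrict_space1) auto
    then show "(\<lambda>a. (a, 0)) \<in> ?N \<rightarrow>\<^sub>M (lborel :: (real \<times> real) measure)"
      unfolding borel_prod by simp
  qed (auto simp: space_restrict_space S_set_iff)
  have snd_S: "snd \<in> borel_measurable S_measure"
    unfolding S_measure_def by (intro measurable_restrict_space1) (simp flip: borel_prod)
  have T: "(gauss_ext q ^^ n) \<in> S_measure \<rightarrow>\<^sub>M S_measure" for n
    using gauss_ext_measurable by (rule measurable_compose_n)
  have "(\<lambda>z. snd ((gauss_ext q ^^ n) (fst ((gauss_inv ^^ n) z), 0))) \<in> borel_measurable \<Sigma>" for n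
    by (rule measurable_compose[OF measurable_compose[OF measurable_compose[OF past zero] T] snd_S])
  then have snd_meas: "snd \<in> borel_measurable \<Sigma>"
    by (rule borel_measurable_LIMSEQ_real[rotated]) (use past_determines_snd in \<open>simp add: sp\<close>)
  have fst_meas: "fst \<in> borel_measurable \<Sigma>"
    using past[of 0] by (simp add: measurable_restrict_space2_iff)
  have "(\<lambda>z. (fst z, snd z)) \<in> \<Sigma> \<rightarrow>\<^sub>M borel \<Otimes>\<^sub>M borel"
    using fst_meas snd_meas by (rule measurable_Pair)
  then have "(\<lambda>z. z) \<in> \<Sigma> \<rightarrow>\<^sub>M borel" unfolding borel_prod by simp
  moreover have "A \<in> sets borel" using A by (simp add: sets_R_measure sets_S_measure)
  ultimately have "(\<lambda>z. z) -` A \<inter> space \<Sigma> \<in> sets \<Sigma>" by (rule measurable_sets)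
  then show ?thesis by (simp add: sp st)
qed

lemma gauss_natural_extension:
  "natural_extension (R_measure q) (gauss_ext q) (gauss_measure q) (gauss q) fst"
  unfolding natural_extension_def
proof (intro conjI exI[of _ "core_set q"] ballI)
  show "AE z in R_measure q. fst (gauss_ext q z) = gauss q (fst z)"
    using R_set_subset[OF q3] by (intro AE_I2) (auto simp: space_R_measure fst_gauss_ext[OF q3])
  show "bijective_on_conull (R_measure q) (gauss_ext q) (core_set q)"
    using core_set_conull gauss_ext_bij[OF q3] by (simp add: bijective_on_conull_def)
  have "gauss_inv \<in> S_measure \<rightarrow>\<^sub>M S_measure" by measurable
  then have "gauss_inv \<in> restrict_space S_measure (core_set q) \<rightarrow>\<^sub>M restrict_space S_measure (core_set q)"
    using gauss_inv_core_set(1)[of _ 1] by (intro measurable_restrict_space3) auto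
  moreover have "restrict_space (R_measure q) (core_set q) = restrict_space S_measure (core_set q)"
  proof -
    have "R_set q \<inter> core_set q = core_set q" by auto
    then show ?thesis
      unfolding R_measure_eq by (simp only: restrict_restrict_space[OF Int_space_S_measure])
  qed
  ultimately have "gauss_inv \<in> restrict_space (R_measure q) (core_set q) \<rightarrow>\<^sub>M restrict_space (R_measure q) (core_set q)" by simp
  then show "the_inv_into (core_set q) (gauss_ext q) \<in> restrict_space (R_measure q) (core_set q) \<rightarrow>\<^sub>M restrict_space (R_measure q) (core_set q)"
    by (rule measurable_cong[THEN iffD1, rotated]) (simp add: space_restrict_space gauss_ext_inverse[OF q3])
  fix A assume A: "A \<in> sets (R_measure q)"
  \<comment> \<open>The approximating set is \<open>A \<inter> core_set q\<close>, which lies in the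
    generated sigma-algebra itself.\<close>
  have "sym_diff A (A \<inter> core_set q) \<in> null_sets (R_measure q)"
  proof (rule null_sets_subset[OF core_set_conull(2)])
    show "sym_diff A (A \<inter> core_set q) \<in> sets (R_measure q)" using A core_set_conull(1) by auto
    show "sym_diff A (A \<inter> core_set q) \<subseteq> space (R_measure q) - core_set q" using A sets.sets_into_space[OF A] by auto
  qed
  then show "\<exists>B\<in>sigma_sets (core_set q) {(gauss_ext q ^^ n) ` (fst -` E \<inter> core_set q) |n E. E \<in> sets (gauss_measure q)}.
      sym_diff A B \<in> null_sets (R_measure q)"
    using borel_generated_by_past[OF A] by blast
qed (rule gauss_ext_measure_preserving fst_R_measurable distr_fst)+

lemma R_fun_diff_first:
  assumes "a \<in> I_set q 0"
  shows "R_fun q (q - 2) a (1 - a) - R_fun q 0 a (1 - a) = ereal (gauss_density q a)"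
proof -
  let ?L = "hecke_lambda q"
  have "0 < a" "a \<le> 1" using I_set_bounds(1)[OF assms] by auto
  then have "a * (a + ?L * (1 - a)) \<noteq> 0"
    using hecke_lambda_ge_1[OF q3] by (smt (verit) mult_nonneg_nonneg mult_pos_pos)
  then have "R_fun q (q - 2) a (1 - a) = ereal (?L / (a * (a + ?L * (1 - a))))"
    by (simp add: R_fun_def sq_simps[OF q3] sin_quot_special)
  moreover have "R_fun q 0 a (1 - a) = 0"
    using \<open>0 < a\<close> by (simp add: R_fun_def sq_simps[OF q3])
  ultimately show ?thesis using assms by (simp add: gauss_density_def)
qed

lemma R_fun_diff_last:
  assumes "a \<in> I_set q (q - 2)"
  shows "R_fun q (q - 1) a (1 - a) - R_fun q 1 a (1 - a) = ereal (gauss_density q a)"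
proof -
  let ?L = "hecke_lambda q"
  have a: "0 < a" "a \<le> 1/2" using I_set_bounds(2)[OF assms] by auto
  have q: "Suc (q - 2) = q - 1" "Suc (q - 1) = q" using q3 by auto
  note sp = sin_quot_special(3,4)[unfolded q]
  have La: "0 \<le> ?L * a" using a hecke_lambda_ge_1[OF q3] by simp
  have nz: "a * (1 - a) \<noteq> 0" "a * (?L * a + (1 - a)) \<noteq> 0"
    using a La by auto
  have "R_fun q (q - 1) a (1 - a) = ereal (1 / (a * (1 - a)))"
    using nz(1) by (simp add: R_fun_def yw_eq[OF q3] xw_eq[OF q3] q sp del: One_nat_def)
  moreover have "R_fun q 1 a (1 - a) = ereal (1 / (a * (?L * a + (1 - a))))"
    using nz(2) by (simp add: R_fun_def sq_simps[OF q3] sin_quot_special)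
  moreover have "1 / (a * (1 - a)) - 1 / (a * (?L * a + (1 - a))) = ?L / ((1 - a) * ((1 - a) + ?L * a))"
    using a hecke_lambda_ge_1[OF q3] by (intro reciprocal_diff) auto
  moreover have "a \<notin> I_set q 0"
    using first_last_distinct[OF q3] assms by blast
  ultimately show ?thesis
    using assms by (simp add: gauss_density_def)
qed

end

theorem theorem4p2:
  fixes q :: nat
  assumes "q \<ge> 3"
  shows
    "I_set q 0 = {hecke_lambda q / (hecke_lambda q + 1) <.. 1} \<and>
     I_set q (q - 2) = {0 <.. 1 / (hecke_lambda q + 1)} \<and>
     R_set q \<in> sets lborel \<and>
     gauss_ext q \<in> R_set q \<rightarrow> R_set q \<and>
     ae_bijective (R_measure q) (gauss_ext q) \<and>
     measure_preserving (R_measure q) (gauss_ext q) \<and>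
     natural_extension (R_measure q) (gauss_ext q) (gauss_measure q) (gauss q) fst \<and>
     gauss q \<in> {0<..1} \<rightarrow> {0<..1} \<and>
     (\<forall>a \<in> I_set q 0.
        R_fun q (q - 2) a (1 - a) - R_fun q 0 a (1 - a) = ereal (gauss_density q a)) \<and>
     (\<forall>a \<in> I_set q (q - 2).
        R_fun q (q - 1) a (1 - a) - R_fun q 1 a (1 - a) = ereal (gauss_density q a)) \<and>
     finite_measure (gauss_measure q) \<and>
     measure_preserving (gauss_measure q) (gauss q)"
proof (intro conjI ballI)
  note q = assms
  show "R_set q \<in> sets lborel" using R_set_S_measure[OF q] by (simp add: sets_S_measure)
  show "gauss_ext q \<in> R_set q \<rightarrow> R_set q" using gauss_ext_in_R[OF q] by blast
  show "ae_bijective (R_measure q) (gauss_ext q)"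
    using core_set_conull[OF q] gauss_ext_bij[OF q] unfolding ae_bijective_def bijective_on_conull_def by blast
  show "gauss q \<in> {0<..1} \<rightarrow> {0<..1}" using gauss_range[OF q] by blast
  show "finite_measure (gauss_measure q)" by (rule finite_gauss_measure[OF q])
  show "measure_preserving (gauss_measure q) (gauss q)" by (rule gauss_measure_preserving[OF q])
qed (simp_all only: I_set_0 I_set_last gauss_ext_measure_preserving gauss_natural_extension
    R_fun_diff_first R_fun_diff_last assms)


end
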